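(* Let $N$ be a positive integer and let $B_1\subsetneq M_N$ and $B_2\subsetneq M_N$ be proper unital $C^*$-subalgebras of $M_N$. Assume one of the following conditions holds: (1) $\dim C(B_1)=1=\dim C(B_2)$; (2) $\dim C(B_1)\geq 2$, $\dim C(B_2)=1$ and $B_1$ is $*$-isomorphic to $M_{N/\dim C(B_1)}\oplus\cdots\oplus M_{N/\dim C(B_1)}$ ($\dim C(B_1)$ summands); (3) $\dim C(B_1)=2=\dim C(B_2)$, $B_1$ is $*$-isomorphic to $M_{N/2}\oplus M_{N/2}$ and $B_2$ is $*$-isomorphic to $M_{N/2}\oplus M_{N/(2k)}$ for some integer $k\geq 2$; (4) $\dim C(B_1)\geq 2$, $\dim C(B_2)\geq 3$ and, for $i=1,2$, $B_i$ is $*$-isomorphic to $M_{N/\dim C(B_i)}\oplus\cdots\oplus M_{N/\dim C(B_i)}$ ($\dim C(B_i)$ summands). Then $$\Delta(B_1,B_2):=\{u\in\mathbb{U}(M_N): B_1\cap uB_2u^*=\mathbb{C}\}$$ is dense in $\mathbb{U}(M_N)$.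
   Context: $M_n$ is the algebra of $n\times n$ complex matrices, $\mathbb{U}(M_N)$ is the group of unitary $N\times N$ matrices (with the norm topology), $C(B)$ denotes the center of $B$, and $\dim C(B)$ its complex dimension. A unital $C^*$-subalgebra of $M_N$ is one containing the identity of $M_N$; $\mathbb{C}$ denotes the scalar multiples of the identity. *)

theory Defs
  imports "HOL-Analysis.Analysis" "Jordan_Normal_Form.Schur_Decomposition"
begin

text \<open>
  The ambient algebra \<open>M\<^sub>N\<close> is the type \<^typ>\<open>complex^'n^'n\<close> with \<open>N = CARD('n)\<close>, which is
  automatically positive. Its type-class topology comes from the Euclidean norm on matrix
  entries; in finite dimension this is the topology of the operator norm.
  Here \<^const>\<open>Finite_Cartesian_Product.mat\<close> (qualified, to keep it apart from
  \<^const>\<open>Matrix.mat\<close>) sends \<open>c\<close> to \<open>c\<close> times the identity matrix.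
\<close>

definition cmat_scale :: "complex \<Rightarrow> complex^'n^'n \<Rightarrow> complex^'n^'n" where
  "cmat_scale c = map_matrix ((*) c)"

definition cmat_adjoint :: "complex^'n^'n \<Rightarrow> complex^'n^'n" where
  "cmat_adjoint A = map_matrix cnj (Finite_Cartesian_Product.transpose A)"

text \<open>
  Dimensions and subspaces must be taken over \<^typ>\<open>complex\<close>; the type-class notions
  \<^const>\<open>subspace\<close> and \<^const>\<open>dim\<close> for \<^typ>\<open>complex^'n^'n\<close> are the real ones.
\<close>

global_interpretation cmat: vector_space "cmat_scale :: complex \<Rightarrow> complex^'n^'n \<Rightarrow> complex^'n^'n"
  by unfold_locales
    (simp_all add: cmat_scale_def Finite_Cartesian_Product.vec_eq_iff algebra_simps)

definition unital_cstar_subalgebra :: "(complex^'n^'n) set \<Rightarrow> bool" where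
  "unital_cstar_subalgebra B \<longleftrightarrow>
     cmat.subspace B \<and>
     (\<forall>X\<in>B. \<forall>Y\<in>B. X ** Y \<in> B) \<and>
     (\<forall>X\<in>B. cmat_adjoint X \<in> B) \<and>
     closed B \<and>
     Finite_Cartesian_Product.mat 1 \<in> B"

definition center :: "(complex^'n^'n) set \<Rightarrow> (complex^'n^'n) set" where
  "center B = {X \<in> B. \<forall>Y\<in>B. X ** Y = Y ** X}"

abbreviation center_dim :: "(complex^'n^'n) set \<Rightarrow> nat" where
  "center_dim B \<equiv> cmat.dim (center B)"

text \<open>
  The underlying set of \<open>M\<^bsub>k\<^sub>1\<^esub> \<oplus> \<dots> \<oplus> M\<^bsub>k\<^sub>r\<^esub>\<close>, for \<open>ks = [k\<^sub>1, \<dots>, k\<^sub>r]\<close>. The block sizes are terms,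
  not types, hence the matrices with explicit carriers here; all operations on the direct
  sum are blockwise.
\<close>

definition matrix_direct_sum :: "nat list \<Rightarrow> complex Matrix.mat list set" where
  "matrix_direct_sum ks = {As. list_all2 (\<lambda>A k. A \<in> carrier_mat k k) As ks}"

definition star_isomorphic_direct_sum :: "(complex^'n^'n) set \<Rightarrow> nat list \<Rightarrow> bool" where
  "star_isomorphic_direct_sum B ks \<longleftrightarrow>
     (\<exists>\<phi>. bij_betw \<phi> B (matrix_direct_sum ks) \<and>
        (\<forall>X\<in>B. \<forall>Y\<in>B. \<phi> (X + Y) = map2 (+) (\<phi> X) (\<phi> Y)) \<and>
        (\<forall>c. \<forall>X\<in>B. \<phi> (cmat_scale c X) = map (\<lambda>A. c \<cdot>\<^sub>m A) (\<phi> X)) \<and>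
        (\<forall>X\<in>B. \<forall>Y\<in>B. \<phi> (X ** Y) = map2 (*) (\<phi> X) (\<phi> Y)) \<and>
        (\<forall>X\<in>B. \<phi> (cmat_adjoint X) = map mat_adjoint (\<phi> X)))"

text \<open>
  \<open>B \<cong> M\<^bsub>N/d\<^esub> \<oplus> \<dots> \<oplus> M\<^bsub>N/d\<^esub>\<close> with \<open>d = dim C(B)\<close> summands; that \<open>N/d\<close> is an integer is part of
  the assertion.
\<close>

definition homogeneous_over_center :: "(complex^'n^'n) set \<Rightarrow> bool" where
  "homogeneous_over_center B \<longleftrightarrow>
     center_dim B dvd CARD('n) \<and>
     star_isomorphic_direct_sum B (replicate (center_dim B) (CARD('n) div center_dim B))"

definition unitary_group :: "(complex^'n^'n) set" where
  "unitary_group = {u. u ** cmat_adjoint u = Finite_Cartesian_Product.mat 1 \<and>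
                       cmat_adjoint u ** u = Finite_Cartesian_Product.mat 1}"

definition scalar_matrices :: "(complex^'n^'n) set" where
  "scalar_matrices = range Finite_Cartesian_Product.mat"

definition Delta :: "(complex^'n^'n) set \<Rightarrow> (complex^'n^'n) set \<Rightarrow> (complex^'n^'n) set" where
  "Delta B1 B2 =
     {u \<in> unitary_group. B1 \<inter> (\<lambda>X. u ** X ** cmat_adjoint u) ` B2 = scalar_matrices}"

end

theory Submission
  imports Defs
begin

text \<open>
  Choose \<open>u\<close> in a given ball of the unitary group so that \<open>D = B\<^sub>1 \<inter> u B\<^sub>2 u\<^sup>*\<close> has minimal dimension.
  If \<open>D\<close> is not \<open>\<complex>\<close>, it contains a projection \<open>p\<close> of some rank \<open>0 < r < N\<close>. By minimality \<open>p\<close> is a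
  limit of elements of \<open>B\<^sub>1 \<inter> w u B\<^sub>2 u\<^sup>* w\<^sup>*\<close> as the unitary \<open>w\<close> tends to \<open>1\<close>; differentiating gives
  \<open>[p, q] \<in> B\<^sub>1 + u B\<^sub>2 u\<^sup>*\<close> for all projections \<open>q\<close>, that is,
  \<open>p M (1 - p) = p B\<^sub>1 (1 - p) + p (u B\<^sub>2 u\<^sup>*) (1 - p)\<close>. The left side has dimension \<open>r (N - r)\<close>.
  On the right a proper factor contributes at most \<open>r (N - r) / 4\<close>, an algebra with \<open>d\<close> equal
  multiplicity-free blocks at most \<open>r (N - r) / d\<close>, and the second algebra of case (3) strictly
  less than \<open>r (N - r) / 2\<close>, which is a contradiction in each case. All dimensions below are real
  dimensions, hence twice as large.
\<close>

section \<open>Complex matrices\<close>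

text \<open>Limits of elements of nearby intersections always lie in \<open>D\<close>, so under a
  small perturbation the dimension of the intersection can only drop; minimality forbids the drop.
  The approximating elements need not be projections and need not form a differentiable path, so the
  conjugation by \<open>w\<close> alone is differentiated, modulo the sum of the two algebras. The
  quarter comes from a projection \<open>e\<close> \<noteq> 0, 1 in the commutant of a factor:
  cutting by \<open>e\<close> and cutting by 1 - \<open>e\<close> are both injective on the factor,
  so the corner fits into two smaller corners, of dimensions a b and c d with a + c = r and b + d =
  N - r. The fraction 1/d is Cauchy-Schwarz for the ranks of \<open>p\<close> in the d blocks. As
  fractions of r (N - r), the two contributions are at most 1/4 + 1/4 in case (1), 1/2 + 1/4 in case
  (2), 1/2 + 1/2 in case (3) and 1/2 + 1/3 in case (4). Only case (3) is borderline: equality would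
  force the block of multiplicity k to fill a full matrix algebra.\<close>

no_notation vec_index (infixl "$" 100)
no_notation scalar_prod (infix "\<bullet>" 70)
notation cmat_adjoint ("(_\<^sup>\<dagger>)" [1000] 999)

abbreviation unit_cmat :: "complex^'n^'n" where
  "unit_cmat \<equiv> Finite_Cartesian_Product.mat 1"

lemma cmat_scale_nth [simp]: "cmat_scale c X $ i $ j = c * X $ i $ j"
  by (simp add: cmat_scale_def)

lemma adjoint_nth [simp]: "X\<^sup>\<dagger> $ i $ j = cnj (X $ j $ i)"
  by (simp add: cmat_adjoint_def Finite_Cartesian_Product.transpose_def)

lemma cmat_eqI: "(\<And>i j. X $ i $ j = Y $ i $ j) \<Longrightarrow> (X :: complex^'n^'m) = Y"
  by (simp add: Finite_Cartesian_Product.vec_eq_iff)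

lemma adjoint_adjoint [simp]: "(X\<^sup>\<dagger>)\<^sup>\<dagger> = X"
  by (rule cmat_eqI) simp

lemma adjoint_add [simp]: "(X + Y)\<^sup>\<dagger> = X\<^sup>\<dagger> + Y\<^sup>\<dagger>"
  by (rule cmat_eqI) simp

lemma adjoint_diff [simp]: "(X - Y)\<^sup>\<dagger> = X\<^sup>\<dagger> - Y\<^sup>\<dagger>"
  by (rule cmat_eqI) simp

lemma adjoint_zero [simp]: "0\<^sup>\<dagger> = 0"
  by (rule cmat_eqI) simp

lemma adjoint_scale [simp]: "(cmat_scale c X)\<^sup>\<dagger> = cmat_scale (cnj c) (X\<^sup>\<dagger>)"
  by (rule cmat_eqI) simp

lemma adjoint_unit [simp]: "unit_cmat\<^sup>\<dagger> = unit_cmat"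
  by (rule cmat_eqI) (simp add: Finite_Cartesian_Product.mat_def)

lemma adjoint_mult [simp]: "(X ** Y)\<^sup>\<dagger> = Y\<^sup>\<dagger> ** X\<^sup>\<dagger>"
  by (rule cmat_eqI) (simp add: matrix_matrix_mult_def mult.commute)

lemma scale_mult_left [simp]: "cmat_scale c X ** Y = cmat_scale c (X ** Y)"
  by (rule cmat_eqI) (simp add: matrix_matrix_mult_def sum_distrib_left mult.assoc)

lemma scale_mult_right [simp]: "X ** cmat_scale c Y = cmat_scale c (X ** Y)"
  by (rule cmat_eqI) (simp add: matrix_matrix_mult_def sum_distrib_left mult_ac)

lemma scaleR_eq_scale: "r *\<^sub>R X = cmat_scale (complex_of_real r) X"
  by (rule cmat_eqI) (simp add: complex_eq_iff)

lemma cmat_mult_zero [simp]: "(0::complex^'n^'n) ** X = 0" "X ** (0::complex^'n^'n) = 0"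
  by (simp_all add: matrix_matrix_mult_def Finite_Cartesian_Product.vec_eq_iff)

lemma cmat_mult_unit [simp]: "unit_cmat ** X = X" "X ** unit_cmat = X"
  by (simp_all add: matrix_mul_lid matrix_mul_rid)

lemma cmat_add_mult: "((X::complex^'n^'n) + Y) ** Z = X ** Z + Y ** Z"
  by (rule cmat_eqI) (simp add: matrix_matrix_mult_def sum.distrib algebra_simps)

lemma cmat_mult_add: "(X::complex^'n^'n) ** (Y + Z) = X ** Y + X ** Z"
  by (rule cmat_eqI) (simp add: matrix_matrix_mult_def sum.distrib algebra_simps)

lemma cmat_diff_mult: "((X::complex^'n^'n) - Y) ** Z = X ** Z - Y ** Z"
  by (rule cmat_eqI) (simp add: matrix_matrix_mult_def sum_subtractf algebra_simps)

lemma cmat_mult_diff: "(X::complex^'n^'n) ** (Y - Z) = X ** Y - X ** Z"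
  by (rule cmat_eqI) (simp add: matrix_matrix_mult_def sum_subtractf algebra_simps)

lemmas cmat_distribs = cmat_add_mult cmat_mult_add cmat_diff_mult cmat_mult_diff

lemma cmat_sum_mult: "(\<Sum>i\<in>A. f i) ** Z = (\<Sum>i\<in>A. f i ** Z)" for Z :: "complex^'n^'n" and f :: "'b \<Rightarrow> complex^'n^'n"
  by (induction A rule: infinite_finite_induct) (auto simp: cmat_distribs)

lemma cmat_mult_sum: "Z ** (\<Sum>i\<in>A. f i) = (\<Sum>i\<in>A. Z ** f i)" for Z :: "complex^'n^'n" and f :: "'b \<Rightarrow> complex^'n^'n"
  by (induction A rule: infinite_finite_induct) (auto simp: cmat_distribs)

lemma mat_eq_scale: "Finite_Cartesian_Product.mat c = cmat_scale c unit_cmat"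
  by (rule cmat_eqI) (simp add: Finite_Cartesian_Product.mat_def)

lemma scalar_matrices_eq: "scalar_matrices = range (\<lambda>c. cmat_scale c unit_cmat)"
  unfolding scalar_matrices_def by (rule arg_cong[where f = range], rule ext, rule mat_eq_scale)

lemma unit_cmat_nonzero [simp]: "(unit_cmat :: complex^'n^'n) \<noteq> 0"
proof
  assume "(unit_cmat :: complex^'n^'n) = 0"
  then have "(unit_cmat :: complex^'n^'n) $ i $ i = 0" for i
    by simp
  then show False
    by (simp add: Finite_Cartesian_Product.mat_def)
qed

section \<open>Real trace and Hilbert-Schmidt inner product\<close>

definition rtrace :: "complex^'n^'n \<Rightarrow> real" where
  "rtrace X = Re (trace X)"

lemma rtrace_add: "rtrace (X + Y) = rtrace X + rtrace Y"
  and rtrace_diff: "rtrace (X - Y) = rtrace X - rtrace Y"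
  and rtrace_zero [simp]: "rtrace 0 = 0"
  by (simp_all add: rtrace_def trace_def sum.distrib sum_subtractf)

lemma rtrace_sum: "rtrace (\<Sum>i\<in>A. f i) = (\<Sum>i\<in>A. rtrace (f i))"
  by (induction A rule: infinite_finite_induct) (auto simp: rtrace_add)

lemma rtrace_unit: "rtrace (unit_cmat :: complex^'n^'n) = real CARD('n)"
  by (simp add: rtrace_def trace_def Finite_Cartesian_Product.mat_def)

lemma rtrace_commute: "rtrace (X ** Y) = rtrace (Y ** X)"
  unfolding rtrace_def by (subst trace_mul_sym) (rule refl)

text \<open>The type-class inner product is the real part of the Hilbert-Schmidt product, so norms,
  orthogonality and real dimensions can be computed with traces.\<close>

lemma inner_cmat_eq_rtrace: "X \<bullet> Y = rtrace (X ** Y\<^sup>\<dagger>)" for X Y :: "complex^'n^'n"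
  by (simp add: inner_vec_def inner_complex_def rtrace_def trace_def matrix_matrix_mult_def)

lemma adjoint_mult_eq_zero: "X\<^sup>\<dagger> ** X = 0 \<Longrightarrow> X = 0" for X :: "complex^'n^'n"
  using inner_cmat_eq_rtrace[of X X] rtrace_commute[of X "X\<^sup>\<dagger>"] by simp

text \<open>The matrix form of ker h^2 = ker h. It is the only cancellation rule used for hermitian
  elements.\<close>

lemma hermitian_cancel:
  fixes h W :: "complex^'n^'n"
  assumes "h\<^sup>\<dagger> = h" "h ** (h ** W) = 0"
  shows "h ** W = 0"
proof (rule adjoint_mult_eq_zero)
  have "(h ** W)\<^sup>\<dagger> ** (h ** W) = W\<^sup>\<dagger> ** (h ** (h ** W))"
    by (simp add: assms matrix_mul_assoc)
  then show "(h ** W)\<^sup>\<dagger> ** (h ** W) = 0"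
    by (simp add: assms)
qed

lemma cmat_mult_scaleR_vec: "X *v (r *\<^sub>R x) = r *\<^sub>R (X *v x)" for X :: "complex^'n^'n"
  by (simp add: Finite_Cartesian_Product.vec_eq_iff matrix_vector_mult_def scaleR_sum_right)

lemma cmat_scaleR_mult_vec: "(r *\<^sub>R X) *v x = r *\<^sub>R (X *v x)" for X :: "complex^'n^'n"
  by (simp add: Finite_Cartesian_Product.vec_eq_iff matrix_vector_mult_def scaleR_sum_right)

lemma inner_matrix_vector: "(X *v x) \<bullet> y = x \<bullet> (X\<^sup>\<dagger> *v y)" for X :: "complex^'n^'n"
proof -
  have ip: "a \<bullet> b = Re (\<Sum>i\<in>UNIV. a $ i * cnj (b $ i))" for a b :: "complex^'n"
    by (simp add: inner_vec_def inner_complex_def)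
  have "(\<Sum>i\<in>UNIV. (X *v x) $ i * cnj (y $ i)) = (\<Sum>i\<in>UNIV. \<Sum>j\<in>UNIV. X $ i $ j * x $ j * cnj (y $ i))"
    by (simp add: matrix_vector_mult_def sum_distrib_right)
  also have "\<dots> = (\<Sum>j\<in>UNIV. \<Sum>i\<in>UNIV. X $ i $ j * x $ j * cnj (y $ i))"
    by (rule sum.swap)
  also have "\<dots> = (\<Sum>j\<in>UNIV. x $ j * cnj ((X\<^sup>\<dagger> *v y) $ j))"
    by (simp add: matrix_vector_mult_def sum_distrib_left mult_ac)
  finally show ?thesis
    by (simp add: ip)
qed

section \<open>Projections\<close>

definition projection :: "complex^'n^'n \<Rightarrow> bool" where
  "projection p \<longleftrightarrow> p\<^sup>\<dagger> = p \<and> p ** p = p"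

lemma projectionD: "projection p \<Longrightarrow> p\<^sup>\<dagger> = p" "projection p \<Longrightarrow> p ** p = p"
  by (auto simp: projection_def)

lemma projection_rtrace: "projection p \<Longrightarrow> rtrace p = norm p ^ 2"
  by (simp add: power2_norm_eq_inner inner_cmat_eq_rtrace projectionD)

lemma projection_rtrace_nonneg: "projection p \<Longrightarrow> 0 \<le> rtrace p"
  by (simp add: projection_rtrace)

lemma projection_rtrace_pos: "projection p \<Longrightarrow> p \<noteq> 0 \<Longrightarrow> 0 < rtrace p"
  by (simp add: projection_rtrace)

lemma projection_zero [simp]: "projection 0" and projection_unit [simp]: "projection unit_cmat"
  by (simp_all add: projection_def)

lemma subprojection_commute:
  assumes "projection p" "projection q" "p ** q = q"
  shows "q ** p = q"
  using assms by (metis adjoint_mult projectionD(1))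

lemma projection_diff:
  assumes "projection p" "projection q" "p ** q = q"
  shows "projection (p - q)"
  using assms subprojection_commute[OF assms] by (simp add: projection_def cmat_distribs)

lemma projection_compl: "projection p \<Longrightarrow> projection (unit_cmat - p)"
  by (rule projection_diff) auto

lemma projection_mult:
  assumes "projection p" "projection q" "p ** q = q ** p"
  shows "projection (p ** q)"
  unfolding projection_def
proof
  show "(p ** q)\<^sup>\<dagger> = p ** q"
    using assms by (simp add: projectionD)
  have "p ** q ** (p ** q) = p ** (q ** p) ** q"
    by (simp add: matrix_mul_assoc)
  also have "\<dots> = (p ** p) ** (q ** q)"
    by (simp flip: assms(3) add: matrix_mul_assoc)
  finally show "p ** q ** (p ** q) = p ** q"
    using assms by (simp add: projectionD)
qed

section \<open>Matrices of rank one\<close>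

definition outer :: "complex^'n \<Rightarrow> complex^'n \<Rightarrow> complex^'n^'n" where
  "outer x y = (\<chi> i j. x $ i * cnj (y $ j))"

lemma outer_nth [simp]: "outer x y $ i $ j = x $ i * cnj (y $ j)"
  by (simp add: outer_def)

lemma adjoint_outer [simp]: "(outer x y)\<^sup>\<dagger> = outer y x"
  by (rule cmat_eqI) simp

lemma mult_outer: "X ** outer x y = outer (X *v x) y"
  by (rule cmat_eqI)
     (simp add: matrix_matrix_mult_def matrix_vector_mult_def sum_distrib_right mult.assoc)

lemma outer_mult: "outer x y ** X = outer x (X\<^sup>\<dagger> *v y)"
  by (rule cmat_eqI)
     (simp add: matrix_matrix_mult_def matrix_vector_mult_def sum_distrib_left mult_ac)

lemma outer_mult_outer: "outer x y ** outer z w = cmat_scale (\<Sum>i\<in>UNIV. z $ i * cnj (y $ i)) (outer x w)"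
  by (rule cmat_eqI)
     (simp add: matrix_matrix_mult_def sum_distrib_left sum_distrib_right mult_ac)

lemma cinner_self: "(\<Sum>i\<in>UNIV. x $ i * cnj (x $ i)) = complex_of_real (norm x ^ 2)" for x :: "complex^'n"
proof -
  have "(\<Sum>i\<in>UNIV. x $ i * cnj (x $ i)) = (\<Sum>i\<in>UNIV. complex_of_real (x $ i \<bullet> x $ i))"
    by (simp add: inner_complex_def complex_mult_cnj power2_eq_square)
  then show ?thesis
    by (simp add: power2_norm_eq_inner inner_vec_def del: of_real_power)
qed

lemma projection_outer: "norm x = 1 \<Longrightarrow> projection (outer x x)"
  by (simp add: projection_def outer_mult_outer cinner_self)

lemma rtrace_outer: "rtrace (outer x x) = norm x ^ 2"
  using cinner_self[of x] by (simp add: rtrace_def trace_def complex_eq_iff)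

lemma cmat_eq_sum_outer:
  fixes X :: "complex^'n^'n"
  shows "X = (\<Sum>i\<in>UNIV. \<Sum>j\<in>UNIV. cmat_scale (X $ i $ j) (outer (axis i 1) (axis j 1)))"
proof (rule cmat_eqI)
  fix k l
  have "(\<Sum>i\<in>UNIV. \<Sum>j\<in>UNIV. X $ i $ j * ((axis i 1 :: complex^'n) $ k * cnj ((axis j 1 :: complex^'n) $ l)))
      = (\<Sum>i\<in>UNIV. \<Sum>j\<in>UNIV. if i = k then if j = l then X $ i $ j else 0 else 0)"
    by (intro sum.cong) (auto simp: axis_def)
  also have "\<dots> = (\<Sum>i\<in>UNIV. if i = k then X $ i $ l else 0)"
    by (intro sum.cong) auto
  also have "\<dots> = X $ k $ l"
    by simp
  finally show "X $ k $ l = (\<Sum>i\<in>UNIV. \<Sum>j\<in>UNIV. cmat_scale (X $ i $ j) (outer (axis i 1) (axis j 1))) $ k $ l"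
    by simp
qed

lemma cmat_nonzero_vector:
  fixes X :: "complex^'n^'n"
  assumes "X \<noteq> 0"
  obtains v where "X *v v \<noteq> 0"
  using assms matrix_eq[of X 0] by (metis matrix_vector_mult_0)

text \<open>The trace serves as the rank of a projection. Splitting off a unit vector of the range
  lowers the trace by one and leaves a projection, whose trace is nonnegative; the induction runs
  over an integer upper bound of the trace.\<close>

lemma projection_rtrace_nat:
  assumes "projection p"
  obtains n :: nat where "rtrace p = real n"
proof -
  have "\<exists>n. rtrace p = real n" if "projection p" "rtrace p \<le> real m" for m :: nat and p :: "complex^'n^'n"
    using that
  proof (induction m arbitrary: p)
    case 0
    then have "rtrace p = 0"
      using projection_rtrace_nonneg[of p] by simp
    then show ?case
      by (intro exI[of _ 0]) simp
  next
    case (Suc m)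
    show ?case
    proof (cases "p = 0")
      case True
      then show ?thesis
        by (intro exI[of _ 0]) simp
    next
      case False
      then obtain x where x: "p *v x \<noteq> 0"
        by (rule cmat_nonzero_vector)
      define v where "v = (1 / norm (p *v x)) *\<^sub>R (p *v x)"
      have v: "norm v = 1"
        using x by (simp add: v_def)
      have pv: "p *v v = v"
        using Suc.prems(1)
        by (simp add: v_def cmat_mult_scaleR_vec matrix_vector_mul_assoc projectionD)
      have "projection (p - outer v v)"
        using Suc.prems v pv by (intro projection_diff projection_outer) (auto simp: mult_outer)
      moreover have tr: "rtrace (p - outer v v) = rtrace p - 1"
        using v by (simp add: rtrace_diff rtrace_outer)
      ultimately obtain n where "rtrace (p - outer v v) = real n"
        using Suc.IH[of "p - outer v v"] Suc.prems by auto
      then show ?thesis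
        using tr by (intro exI[of _ "Suc n"]) simp
    qed
  qed
  from this[OF assms, of "nat \<lceil>rtrace p\<rceil>"] that show thesis
    by (metis real_nat_ceiling_ge)
qed

text \<open>The quadratic form of \<open>h\<close> attains its maximum on the unit sphere of the
  range of \<open>e\<close>, and a maximiser is an eigenvector.\<close>

lemma hermitian_eigenvector:
  fixes h e :: "complex^'n^'n"
  assumes h: "h\<^sup>\<dagger> = h" "e ** h = h" and e: "projection e" "e \<noteq> 0"
  obtains l :: real and v where "v \<noteq> 0" "e *v v = v" "h *v v = l *\<^sub>R v"
proof -
  define S where "S = {v. e *v v = v} \<inter> sphere 0 1"
  define f where "f v = (h *v v) \<bullet> v" for v
  obtain x where x: "e *v x \<noteq> 0"
    using e by (blast elim: cmat_nonzero_vector)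
  have contm: "continuous_on A (\<lambda>v. X *v v)" for X :: "complex^'n^'n" and A
    by (intro linear_continuous_on) (simp add: linear_conv_bounded_linear[symmetric])
  have "(1 / norm (e *v x)) *\<^sub>R (e *v x) \<in> S"
    using x e by (simp add: S_def cmat_mult_scaleR_vec matrix_vector_mul_assoc projectionD)
  then have "S \<noteq> {}"
    by auto
  have "closed {v. e *v v = v}"
    by (intro closed_Collect_eq contm continuous_on_id)
  then have "compact S"
    unfolding S_def by (intro closed_Int_compact compact_sphere)
  have "continuous_on S f"
    unfolding f_def by (intro continuous_intros contm)
  then obtain v where v: "v \<in> S" "\<And>w. w \<in> S \<Longrightarrow> f w \<le> f v"
    using continuous_attains_sup[OF \<open>compact S\<close> \<open>S \<noteq> {}\<close>] by blast
  define l where "l = f v"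
  have bound: "f w \<le> l * (w \<bullet> w)" if "e *v w = w" for w
  proof (cases "w = 0")
    case False
    have "(1 / norm w) *\<^sub>R w \<in> S"
      using that False by (simp add: S_def cmat_mult_scaleR_vec)
    from v(2)[OF this] have "f w / (norm w)^2 \<le> l"
      using False by (simp add: f_def l_def cmat_mult_scaleR_vec power2_eq_square)
    then show ?thesis
      using False by (simp add: divide_simps power2_norm_eq_inner[symmetric])
  qed (simp add: f_def)
  \<comment> \<open>The defect of the eigenvalue equation. Because of \<open>e ** h = h\<close> it
    lies in the range of \<open>e\<close>, so \<open>v\<close> may be varied in this direction;
    maximality then gives \<open>quad\<close>, whose linear coefficient is
    \<open>2 * (w \<bullet> w)\<close>.\<close>
  define w where "w = l *\<^sub>R v - h *v v"
  have ev: "e *v v = v" and nv: "v \<bullet> v = 1"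
    using v(1) by (auto simp: S_def dot_square_norm)
  have ew: "e *v w = w"
    using ev h by (simp add: w_def cmat_mult_scaleR_vec matrix_vector_mult_diff_distrib matrix_vector_mul_assoc)
  have sym: "(h *v w) \<bullet> v = (h *v v) \<bullet> w"
    using inner_matrix_vector[of h w v] h by (simp add: inner_commute)
  have quad: "0 \<le> 2 * t * (w \<bullet> w) + t^2 * (l * (w \<bullet> w) - f w)" for t
  proof -
    have "f (v + t *\<^sub>R w) \<le> l * ((v + t *\<^sub>R w) \<bullet> (v + t *\<^sub>R w))"
      using ev ew by (intro bound) (simp add: matrix_vector_right_distrib cmat_mult_scaleR_vec)
    also have "(v + t *\<^sub>R w) \<bullet> (v + t *\<^sub>R w) = 1 + 2 * t * (v \<bullet> w) + t^2 * (w \<bullet> w)"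
      by (simp add: inner_simps nv inner_commute power2_eq_square algebra_simps)
    also have "f (v + t *\<^sub>R w) = l + 2 * t * ((h *v v) \<bullet> w) + t^2 * f w"
      by (simp add: f_def l_def matrix_vector_right_distrib cmat_mult_scaleR_vec inner_simps sym
          power2_eq_square algebra_simps)
    finally have "0 \<le> 2 * t * (l * (v \<bullet> w) - (h *v v) \<bullet> w) + t^2 * (l * (w \<bullet> w) - f w)"
      by (simp add: algebra_simps)
    moreover have "l * (v \<bullet> w) - (h *v v) \<bullet> w = (l *\<^sub>R v - h *v v) \<bullet> w"
      by (simp add: inner_simps)
    ultimately show ?thesis
      by (simp add: w_def)
  qed
  have "w = 0"
  proof (rule ccontr)
    assume "w \<noteq> 0"
    define a where "a = w \<bullet> w"
    define b where "b = l * (w \<bullet> w) - f w"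
    have a: "a > 0" and b: "b \<ge> 0"
      using \<open>w \<noteq> 0\<close> bound[OF ew] by (auto simp: a_def b_def)
    \<comment> \<open>Negative, and small enough for the linear term to beat the quadratic one; the
      summand 1 keeps the denominator positive when \<open>b = 0\<close>.\<close>
    define t where "t = - a / (b + 1)"
    have "0 \<le> 2 * t * a + t^2 * b"
      using quad[of t] by (simp add: a_def b_def)
    also have "\<dots> = (a^2 / (b+1)^2) * (b - 2 * (b + 1))"
      using b by (simp add: t_def divide_simps power2_eq_square) (simp add: algebra_simps)
    also have "\<dots> < 0"
      using a b by (intro mult_pos_neg) auto
    finally show False
      by simp
  qed
  then have "h *v v = l *\<^sub>R v"
    by (simp add: w_def)
  moreover have "v \<noteq> 0"
    using nv by auto
  ultimately show thesis
    using that ev by blast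
qed

section \<open>Projections in star algebras\<close>

text \<open>No unit is required, so the notion also covers annihilator ideals and the algebra of
  matrices living on a subspace. That every such algebra has a unit of its own is
  \<open>star_algebra_unit\<close>.\<close>

definition star_algebra :: "(complex^'n^'n) set \<Rightarrow> bool" where
  "star_algebra J \<longleftrightarrow> cmat.subspace J \<and> (\<forall>X\<in>J. \<forall>Y\<in>J. X ** Y \<in> J) \<and> (\<forall>X\<in>J. X\<^sup>\<dagger> \<in> J)"

lemma star_algebraD:
  assumes "star_algebra J"
  shows "cmat.subspace J"
    and "0 \<in> J"
    and "\<And>X Y. X \<in> J \<Longrightarrow> Y \<in> J \<Longrightarrow> X + Y \<in> J"
    and "\<And>X Y. X \<in> J \<Longrightarrow> Y \<in> J \<Longrightarrow> X - Y \<in> J"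
    and "\<And>c X. X \<in> J \<Longrightarrow> cmat_scale c X \<in> J"
    and "\<And>X Y. X \<in> J \<Longrightarrow> Y \<in> J \<Longrightarrow> X ** Y \<in> J"
    and "\<And>X. X \<in> J \<Longrightarrow> X\<^sup>\<dagger> \<in> J"
  using assms unfolding star_algebra_def
  by (auto simp: cmat.subspace_0 cmat.subspace_add cmat.subspace_diff cmat.subspace_scale)

lemma star_algebraI:
  assumes "0 \<in> J"
    and "\<And>X Y. X \<in> J \<Longrightarrow> Y \<in> J \<Longrightarrow> X + Y \<in> J"
    and "\<And>c X. X \<in> J \<Longrightarrow> cmat_scale c X \<in> J"
    and "\<And>X Y. X \<in> J \<Longrightarrow> Y \<in> J \<Longrightarrow> X ** Y \<in> J"
    and "\<And>X. X \<in> J \<Longrightarrow> X\<^sup>\<dagger> \<in> J"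
  shows "star_algebra J"
  using assms by (simp add: star_algebra_def cmat.subspace_def)

lemma cmat_subspace_imp_subspace: "cmat.subspace S \<Longrightarrow> Real_Vector_Spaces.subspace S"
  by (simp add: real_vector.subspace_def cmat.subspace_def scaleR_eq_scale)

text \<open>Cancellation of \<open>h\<close> on the left, then on the right by passing to adjoints.
  It gives injectivity of x \<mapsto> h x h on h J h.\<close>

lemma hermitian_cancel_corner:
  fixes h y :: "complex^'n^'n"
  assumes h: "h\<^sup>\<dagger> = h" and z: "h ** (h ** y ** h) ** h = 0"
  shows "h ** y ** h = 0"
proof -
  have "h ** (h ** (y ** h ** h)) = 0"
    using z by (simp add: matrix_mul_assoc)
  then have "h ** y ** h ** h = 0"
    using hermitian_cancel[OF h, of "y ** h ** h"] by (simp add: matrix_mul_assoc)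
  then have "(h ** y ** h ** h)\<^sup>\<dagger> = 0"
    by (simp only: adjoint_zero)
  then have "h ** (h ** (y\<^sup>\<dagger> ** h)) = 0"
    by (simp add: h matrix_mul_assoc)
  then have "h ** (y\<^sup>\<dagger> ** h) = 0"
    using hermitian_cancel[OF h] by blast
  then have "(h ** (y\<^sup>\<dagger> ** h))\<^sup>\<dagger> = 0"
    by (simp only: adjoint_zero)
  then show ?thesis
    by (simp add: h matrix_mul_assoc)
qed

text \<open>
  The map \<open>x \<mapsto> h x h\<close> is injective on \<open>h J h\<close>, hence onto, so \<open>h\<close> has an inverse \<open>x\<close>
  inside \<open>h J h\<close>, and \<open>h x\<close> is the support projection of \<open>h\<close>.
\<close>
lemma support_projection:
  assumes J: "star_algebra J" and hJ: "h \<in> J" and h: "h\<^sup>\<dagger> = h"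
  obtains e w where "projection e" "e \<in> J" "e ** h = h" "h ** e = h" "w \<in> J" "e = h ** w ** h"
proof -
  define L where "L x = h ** x ** h" for x
  define S where "S = L ` J"
  have linL: "linear L"
    by (rule linearI) (simp_all add: L_def cmat_distribs scaleR_eq_scale)
  have subS: "Real_Vector_Spaces.subspace S"
    unfolding S_def using linL J
    by (intro real_vector.linear_subspace_image cmat_subspace_imp_subspace star_algebraD(1))
  have inj: "x = 0" if "x \<in> S" "L x = 0" for x
    using that hermitian_cancel_corner[OF h] by (auto simp: S_def L_def)
  have SJ: "S \<subseteq> J"
    using J hJ by (auto simp: S_def L_def intro: star_algebraD)
  have "inj_on L (span S)"
    unfolding real_vector.span_eq_iff[THEN iffD2, OF subS]
    using inj by (subst real_vector.linear_inj_on_iff_eq_0[OF linL subS]) auto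
  then have "dim (L ` S) = dim S"
    by (rule dim_image_eq[OF linL])
  moreover have "L ` S \<subseteq> S"
    using SJ by (auto simp: S_def)
  ultimately have surj: "L ` S = S"
    using subS linL by (intro subspace_dim_equal real_vector.linear_subspace_image) auto
  \<comment> \<open>Since \<open>J\<close> may lack a unit, it is not immediate that
    \<open>h\<close> lies in \<open>S\<close>. Its cube does; surjectivity turns this into h^2 y h^2
    = h^3, and cancelling \<open>h\<close> on both sides leaves h = h y h.\<close>
  have "h ** h ** h \<in> S"
    using hJ by (auto simp: S_def L_def)
  then obtain x where x: "x \<in> S" "L x = h ** h ** h"
    using surj by (metis imageE)
  then obtain y where y: "y \<in> J" "x = h ** y ** h"
    by (auto simp: S_def L_def)
  have "h ** (h ** ((y ** h - unit_cmat) ** h)) = 0"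
    using x by (simp add: y L_def cmat_distribs matrix_mul_assoc)
  then have "h ** ((y ** h - unit_cmat) ** h) = 0"
    by (rule hermitian_cancel[OF h])
  then have "(h ** ((y ** h - unit_cmat) ** h))\<^sup>\<dagger> = 0"
    by (simp only: adjoint_zero)
  then have "h ** (h ** (y\<^sup>\<dagger> ** h - unit_cmat)) = 0"
    by (simp add: h cmat_distribs matrix_mul_assoc)
  then have "h ** (y\<^sup>\<dagger> ** h - unit_cmat) = 0"
    by (rule hermitian_cancel[OF h])
  then have "(h ** (y\<^sup>\<dagger> ** h - unit_cmat))\<^sup>\<dagger> = 0"
    by (simp only: adjoint_zero)
  then have "h = h ** y ** h"
    by (simp add: h cmat_distribs)
  then have "h \<in> S"
    using x y by simp
  \<comment> \<open>\<open>x'\<close> is the inverse of \<open>h\<close> inside the corner. Its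
    adjoint solves the same equation, so injectivity makes \<open>x'\<close> hermitian, and from
    this \<open>h ** x'\<close> is seen to be a projection.\<close>
  then obtain x' where x': "x' \<in> S" "L x' = h"
    using surj by (metis imageE)
  then obtain y' where y': "y' \<in> J" "x' = h ** y' ** h"
    by (auto simp: S_def L_def)
  have hxh: "h ** x' ** h = h"
    using x' by (simp add: L_def)
  have "x'\<^sup>\<dagger> \<in> S"
    unfolding S_def L_def
    by (rule image_eqI[of _ _ "y'\<^sup>\<dagger>"]) (use y' J h in \<open>auto simp: matrix_mul_assoc intro: star_algebraD\<close>)
  moreover have "L (x'\<^sup>\<dagger> - x') = 0"
  proof -
    have "(h ** x' ** h)\<^sup>\<dagger> = h\<^sup>\<dagger>"
      by (simp add: hxh)
    then have "h ** x'\<^sup>\<dagger> ** h = h"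
      by (simp add: h matrix_mul_assoc)
    then show ?thesis
      using hxh by (simp add: L_def cmat_distribs)
  qed
  ultimately have "x'\<^sup>\<dagger> - x' = 0"
    using inj x'(1) subS real_vector.subspace_diff by blast
  then have hx: "x'\<^sup>\<dagger> = x'"
    by simp
  define e where "e = h ** x'"
  have adj: "e\<^sup>\<dagger> = x' ** h"
    by (simp add: e_def h hx)
  have "e ** x' = h ** x' ** (h ** y' ** h)"
    by (simp only: e_def y'(2)[symmetric])
  also have "\<dots> = (h ** x' ** h) ** y' ** h"
    by (simp only: matrix_mul_assoc)
  also have "\<dots> = x'"
    by (simp only: hxh y'(2)[symmetric])
  finally have "e ** x' = x'" .
  then have ee: "e ** e\<^sup>\<dagger> = e\<^sup>\<dagger>"
    by (simp add: adj matrix_mul_assoc)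
  then have "(e ** e\<^sup>\<dagger>)\<^sup>\<dagger> = e"
    by simp
  then have "e ** e\<^sup>\<dagger> = e"
    by simp
  with ee have eh: "e\<^sup>\<dagger> = e"
    by simp
  with ee have proj: "projection e"
    by (simp add: projection_def)
  have he: "h ** e = h" "e ** h = h"
  proof -
    show *: "e ** h = h"
      by (simp add: e_def hxh)
    then have "(e ** h)\<^sup>\<dagger> = h\<^sup>\<dagger>"
      by simp
    then show "h ** e = h"
      by (simp add: h eh)
  qed
  have eq: "e = h ** (h ** y') ** h"
    by (simp add: e_def y' matrix_mul_assoc)
  have "h ** y' \<in> J"
    using J hJ y' by (intro star_algebraD)
  moreover from this have "e \<in> J"
    unfolding eq using J hJ by (meson star_algebraD(6))
  ultimately show thesis
    using that proj he eq by blast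
qed

text \<open>The support projection of \<open>X\<^sup>\<dagger> ** X\<close> works, because this
  matrix has the same kernel as \<open>X\<close>.\<close>

lemma star_algebra_nonzero_projection:
  assumes J: "star_algebra J" and X: "X \<in> J" "X \<noteq> 0"
  obtains e where "projection e" "e \<in> J" "e \<noteq> 0" "X ** e = X"
proof -
  have "X\<^sup>\<dagger> ** X \<in> J"
    using J X by (intro star_algebraD)
  moreover have "(X\<^sup>\<dagger> ** X)\<^sup>\<dagger> = X\<^sup>\<dagger> ** X"
    by simp
  ultimately obtain e w where e: "projection e" "e \<in> J" "X\<^sup>\<dagger> ** X ** e = X\<^sup>\<dagger> ** X"
    using support_projection[OF J] by metis
  have "(X ** (unit_cmat - e))\<^sup>\<dagger> ** (X ** (unit_cmat - e))
      = (unit_cmat - e)\<^sup>\<dagger> ** (X\<^sup>\<dagger> ** X - X\<^sup>\<dagger> ** X ** e)"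
    by (simp add: cmat_distribs matrix_mul_assoc)
  also have "\<dots> = 0"
    by (simp only: e(3) diff_self cmat_mult_zero)
  finally have "X ** (unit_cmat - e) = 0"
    by (rule adjoint_mult_eq_zero)
  then have "X ** e = X"
    by (simp add: cmat_distribs)
  moreover from this have "e \<noteq> 0"
    using X by auto
  ultimately show thesis
    using that e by blast
qed

text \<open>For projections \<open>e ** f = f\<close> is the order f \<le> e. Minimality is relative
  to \<open>J\<close>, so \<open>e\<close> may have large rank; that rank is the multiplicity of a
  block.\<close>

definition minimal_projection :: "(complex^'n^'n) set \<Rightarrow> complex^'n^'n \<Rightarrow> bool" where
  "minimal_projection J e \<longleftrightarrow> projection e \<and> e \<in> J \<and> e \<noteq> 0 \<and>
     (\<forall>f\<in>J. projection f \<longrightarrow> f \<noteq> 0 \<longrightarrow> e ** f = f \<longrightarrow> f = e)"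

lemma rtrace_subprojection:
  assumes "projection e" "projection f" "e ** f = f"
  shows "rtrace f \<le> rtrace e" "rtrace e = rtrace f \<Longrightarrow> e = f"
  using projection_rtrace_nonneg[OF projection_diff[OF assms]]
    projection_rtrace_pos[OF projection_diff[OF assms]]
  by (auto simp: rtrace_diff)

text \<open>A nonzero projection of least trace is minimal. The floor only supplies a measure in the
  naturals: traces of projections are natural numbers, so it loses nothing.\<close>

lemma ex_minimal_projection:
  assumes J: "star_algebra J" and X: "X \<in> J" "X \<noteq> 0"
  obtains e where "minimal_projection J e"
proof -
  define P where "P e \<longleftrightarrow> projection e \<and> e \<in> J \<and> e \<noteq> 0" for e
  obtain e0 where "P e0"
    using star_algebra_nonzero_projection[OF J X] by (metis P_def)
  then obtain e where e: "P e" "\<And>f. P f \<Longrightarrow> nat \<lfloor>rtrace e\<rfloor> \<le> nat \<lfloor>rtrace f\<rfloor>"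
    using ex_has_least_nat[of P e0 "\<lambda>e. nat \<lfloor>rtrace e\<rfloor>"] by blast
  have "f = e" if f: "f \<in> J" "projection f" "f \<noteq> 0" "e ** f = f" for f
  proof -
    have pe: "projection e"
      using e(1) by (simp add: P_def)
    obtain m n :: nat where "rtrace e = real m" "rtrace f = real n"
      using projection_rtrace_nat pe f(2) by metis
    moreover have "nat \<lfloor>rtrace e\<rfloor> \<le> nat \<lfloor>rtrace f\<rfloor>"
      using f by (intro e) (simp add: P_def)
    ultimately have "rtrace e = rtrace f"
      using rtrace_subprojection(1)[OF pe f(2) f(4)] by simp
    then show ?thesis
      using rtrace_subprojection(2)[OF pe f(2) f(4)] by simp
  qed
  then show thesis
    using e(1) that by (auto simp: P_def minimal_projection_def)
qed

text \<open>For hermitian h in e J e with eigenvector v in the range of \<open>e\<close> and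
  eigenvalue l, the support projection of h - l e lies below \<open>e\<close> and kills v. It is
  therefore not \<open>e\<close>, so it is 0 and h = l e. A general element is split into real and
  imaginary part.\<close>

lemma minimal_projection_corner:
  assumes J: "star_algebra J" and e: "minimal_projection J e" and X: "X \<in> J"
  obtains c where "e ** X ** e = cmat_scale c e"
proof -
  have pe: "projection e" "e \<in> J" "e \<noteq> 0"
    using e by (auto simp: minimal_projection_def)
  have herm: "\<exists>c. e ** H ** e = cmat_scale c e" if H: "H \<in> J" "H\<^sup>\<dagger> = H" for H
  proof -
    define h where "h = e ** H ** e"
    have h: "h\<^sup>\<dagger> = h" "e ** h = h" "h ** e = h" "h \<in> J"
      using H pe J
      by (auto simp: h_def projectionD matrix_mul_assoc intro: star_algebraD)
         (metis matrix_mul_assoc projectionD(2))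
    obtain l v where v: "v \<noteq> 0" "e *v v = v" "h *v v = l *\<^sub>R v"
      using hermitian_eigenvector[OF h(1,2) pe(1,3)] by blast
    define K where "K = h - l *\<^sub>R e"
    have K: "K \<in> J" "K\<^sup>\<dagger> = K" "e ** K = K"
      using h pe J
      by (auto simp: K_def scaleR_eq_scale cmat_distribs projectionD intro: star_algebraD)
    have Kv: "K *v v = 0"
      using v by (simp add: K_def matrix_vector_mult_diff_rdistrib cmat_scaleR_mult_vec)
    obtain f w where f: "projection f" "f \<in> J" "f ** K = K" "f = K ** w ** K"
      using support_projection[OF J K(1,2)] by metis
    have "e ** f = f"
      using K(3) f(4) by (metis matrix_mul_assoc)
    moreover have "f *v v = 0"
      by (simp add: f(4) Kv matrix_vector_mul_assoc[symmetric])
    ultimately have "f = 0"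
      using e f v unfolding minimal_projection_def by metis
    then have "h = l *\<^sub>R e"
      using f(3) by (simp add: K_def)
    then show ?thesis
      by (auto simp: h_def scaleR_eq_scale)
  qed
  define A where "A = cmat_scale (1/2) (X + X\<^sup>\<dagger>)"
  define C where "C = cmat_scale (-\<i>/2) (X - X\<^sup>\<dagger>)"
  have XAC: "X = A + cmat_scale \<i> C"
    by (rule cmat_eqI) (simp add: A_def C_def field_simps)
  have "A \<in> J" "C \<in> J"
    unfolding A_def C_def using J X by (meson star_algebraD(3,4,5,7))+
  moreover have "A\<^sup>\<dagger> = A" "C\<^sup>\<dagger> = C"
    by (rule cmat_eqI; simp add: A_def C_def algebra_simps)+
  ultimately obtain a c where ac: "e ** A ** e = cmat_scale a e" "e ** C ** e = cmat_scale c e"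
    using herm by blast
  have "e ** X ** e = cmat_scale (a + \<i> * c) e"
    by (simp add: XAC cmat_distribs ac cmat.scale_left_distrib)
  then show thesis
    by (rule that)
qed

text \<open>A projection \<open>u\<close> of greatest trace is the unit: if X u \<noteq> X, the
  support projection of Y* Y with Y = X - X u is orthogonal to \<open>u\<close>, and adding it to
  \<open>u\<close> would increase the trace.\<close>

lemma star_algebra_unit:
  assumes J: "star_algebra J"
  obtains u where "u \<in> J" "projection u" "\<And>X. X \<in> J \<Longrightarrow> u ** X = X" "\<And>X. X \<in> J \<Longrightarrow> X ** u = X"
proof -
  define P where "P e \<longleftrightarrow> projection e \<and> e \<in> J" for e
  have "P 0"
    using J by (simp add: P_def star_algebraD)
  \<comment> \<open>The bound is strict, hence \<open>Suc\<close>: the value N itself is attained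
    when \<open>unit_cmat\<close> lies in \<open>J\<close>.\<close>
  moreover have "\<forall>e. P e \<longrightarrow> nat \<lfloor>rtrace e\<rfloor> < Suc CARD('a)"
  proof (intro allI impI)
    fix e assume "P e"
    then have "rtrace e \<le> real CARD('a)"
      using rtrace_subprojection(1)[of unit_cmat e] by (simp add: P_def rtrace_unit)
    then show "nat \<lfloor>rtrace e\<rfloor> < Suc CARD('a)"
      by linarith
  qed
  ultimately have "\<exists>u. P u \<and> (\<forall>f. P f \<longrightarrow> nat \<lfloor>rtrace f\<rfloor> \<le> nat \<lfloor>rtrace u\<rfloor>)"
    by (rule ex_has_greatest_nat)
  then obtain u where u: "P u" "\<And>f. P f \<Longrightarrow> nat \<lfloor>rtrace f\<rfloor> \<le> nat \<lfloor>rtrace u\<rfloor>"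
    by auto
  have pu: "projection u" "u \<in> J"
    using u(1) by (auto simp: P_def)
  have right: "X ** u = X" if X: "X \<in> J" for X
  proof (rule ccontr)
    assume "X ** u \<noteq> X"
    define Y where "Y = X - X ** u"
    have "Y \<in> J" "Y \<noteq> 0"
      using J X pu \<open>X ** u \<noteq> X\<close> by (auto simp: Y_def intro: star_algebraD)
    then have "Y\<^sup>\<dagger> ** Y \<in> J"
      using J by (intro star_algebraD)
    moreover have "(Y\<^sup>\<dagger> ** Y)\<^sup>\<dagger> = Y\<^sup>\<dagger> ** Y"
      by simp
    ultimately obtain f w where f: "projection f" "f \<in> J" "Y\<^sup>\<dagger> ** Y ** f = Y\<^sup>\<dagger> ** Y"
        "f = Y\<^sup>\<dagger> ** Y ** w ** (Y\<^sup>\<dagger> ** Y)"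
      using support_projection[OF J] by metis
    have "Y ** u = 0"
      using pu by (simp add: Y_def cmat_distribs matrix_mul_assoc[symmetric] projectionD)
    then have fu: "f ** u = 0"
      by (simp add: f(4) matrix_mul_assoc[symmetric])
    then have "(f ** u)\<^sup>\<dagger> = 0"
      by (simp only: adjoint_zero)
    then have uf: "u ** f = 0"
      by (simp only: adjoint_mult projectionD(1)[OF f(1)] projectionD(1)[OF pu(1)])
    have "f \<noteq> 0"
      using f(3) adjoint_mult_eq_zero[of Y] \<open>Y \<noteq> 0\<close> by auto
    have pf: "projection (u + f)"
      using f(1) pu(1) by (simp add: projection_def cmat_distribs fu uf)
    have "nat \<lfloor>rtrace (u + f)\<rfloor> \<le> nat \<lfloor>rtrace u\<rfloor>"
      using pf pu f J by (intro u(2)) (simp add: P_def star_algebraD)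
    moreover obtain m n :: nat where "rtrace u = real m" "rtrace f = real n"
      using projection_rtrace_nat pu f(1) by metis
    moreover have "rtrace f > 0"
      using f \<open>f \<noteq> 0\<close> by (intro projection_rtrace_pos)
    ultimately show False
      by (simp add: rtrace_add nat_add_distrib)
  qed
  moreover have "u ** X = X" if X: "X \<in> J" for X
  proof -
    have "(X\<^sup>\<dagger> ** u)\<^sup>\<dagger> = (X\<^sup>\<dagger>)\<^sup>\<dagger>"
      using J X by (simp add: right star_algebraD del: adjoint_adjoint)
    then show ?thesis
      using pu by (simp add: projectionD)
  qed
  ultimately show thesis
    using that pu by blast
qed

text \<open>Any minimal projection will do: if it were 1, the whole algebra would be its corner and
  hence scalar.\<close>

lemma star_algebra_scalar_or_projection:
  assumes J: "star_algebra J" "unit_cmat \<in> J" and ns: "X \<in> J" "X \<notin> scalar_matrices"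
  obtains e where "projection e" "e \<in> J" "e \<noteq> 0" "e \<noteq> unit_cmat"
proof -
  obtain e where e: "minimal_projection J e"
    using ex_minimal_projection[OF J] by auto
  have "e \<noteq> unit_cmat"
  proof
    assume "e = unit_cmat"
    then obtain c where "X = cmat_scale c unit_cmat"
      using minimal_projection_corner[OF J(1) e ns(1)] by auto
    then show False
      using ns(2) by (simp add: scalar_matrices_eq)
  qed
  then show thesis
    using that e by (auto simp: minimal_projection_def)
qed

section \<open>Commutants and factors\<close>

definition commutant :: "(complex^'n^'n) set \<Rightarrow> (complex^'n^'n) set" where
  "commutant B = {Y. \<forall>X\<in>B. X ** Y = Y ** X}"

lemma cmat_scale_mult_vec: "cmat_scale c X *v x = c *s (X *v x)"
  by (simp add: Finite_Cartesian_Product.vec_eq_iff matrix_vector_mult_def sum_distrib_left mult.assoc)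

lemma outer_mult_vec: "outer x y *v z = (\<Sum>i\<in>UNIV. z $ i * cnj (y $ i)) *s x"
  by (simp add: Finite_Cartesian_Product.vec_eq_iff matrix_vector_mult_def sum_distrib_left
      sum_distrib_right mult_ac)

text \<open>The orthogonal projection onto \<open>S\<close> is obtained as the unit of the star
  algebra of all matrices which, together with their adjoints, have range in
  \<open>S\<close>.\<close>

lemma complex_subspace_projection:
  fixes S :: "(complex^'n) set"
  assumes "0 \<in> S" "\<And>x y. x \<in> S \<Longrightarrow> y \<in> S \<Longrightarrow> x + y \<in> S" "\<And>c x. x \<in> S \<Longrightarrow> c *s x \<in> S"
  obtains u where "projection u" "\<And>x. u *v x \<in> S" "\<And>x. x \<in> S \<Longrightarrow> u *v x = x"
proof -
  define T where "T = {X :: complex^'n^'n. (\<forall>x. X *v x \<in> S) \<and> (\<forall>x. X\<^sup>\<dagger> *v x \<in> S)}"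
  have "star_algebra T"
    using assms
    by (intro star_algebraI)
       (auto simp: T_def matrix_vector_mult_add_rdistrib cmat_scale_mult_vec matrix_vector_mul_assoc[symmetric])
  then obtain u where u: "u \<in> T" "projection u" "\<And>X. X \<in> T \<Longrightarrow> u ** X = X"
    using star_algebra_unit by metis
  have "u *v x = x" if x: "x \<in> S" for x
  proof (cases "x = 0")
    case False
    \<comment> \<open>The unit of \<open>T\<close> fixes every element of \<open>T\<close>, in
      particular this one, and hence the vector \<open>x\<close>.\<close>
    have "outer x x \<in> T"
      using x assms(3) by (simp add: T_def outer_mult_vec)
    then have "outer (u *v x) x *v x = outer x x *v x"
      using u(3)[of "outer x x"] by (simp add: mult_outer)
    then show ?thesis
      using False by (simp add: outer_mult_vec cinner_self del: of_real_power)
  qed simp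
  then show thesis
    using that u by (auto simp: T_def)
qed

text \<open>
  Burnside's theorem for star algebras. For a minimal projection \<open>e\<close> of \<open>B\<close> and a unit vector
  \<open>v\<close> in its range, the projection onto \<open>B v\<close> commutes with \<open>B\<close>. If it is \<open>1\<close>, then
  \<open>e B e = \<complex> e\<close> makes \<open>e\<close> the rank one projection onto \<open>v\<close>, and \<open>B e B\<close> contains all matrices of
  rank one.
\<close>
lemma commutant_projection:
  fixes B :: "(complex^'n^'n) set"
  assumes B: "star_algebra B" "unit_cmat \<in> B" "B \<noteq> UNIV"
  obtains e where "projection e" "e \<in> commutant B" "e \<noteq> 0" "e \<noteq> unit_cmat"
proof -
  obtain e where e: "minimal_projection B e"
    using ex_minimal_projection[OF B(1,2)] by auto
  then have pe: "projection e" "e \<in> B" "e \<noteq> 0"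
    by (auto simp: minimal_projection_def)
  then obtain x where x: "e *v x \<noteq> 0"
    by (blast elim: cmat_nonzero_vector)
  define v where "v = (1 / norm (e *v x)) *\<^sub>R (e *v x)"
  have v: "norm v = 1" "e *v v = v" "v \<noteq> 0"
    using x pe by (auto simp: v_def cmat_mult_scaleR_vec matrix_vector_mul_assoc projectionD)
  define S where "S = (\<lambda>b. b *v v) ` B"
  obtain u where u: "projection u" "\<And>x. u *v x \<in> S" "\<And>x. x \<in> S \<Longrightarrow> u *v x = x"
  proof (rule complex_subspace_projection[of S])
    show "0 \<in> S"
      using B by (auto simp: S_def star_algebraD intro!: image_eqI[of _ _ 0])
    show "x + y \<in> S" if "x \<in> S" "y \<in> S" for x y
      using that B by (auto simp: S_def matrix_vector_mult_add_rdistrib[symmetric] intro: star_algebraD)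
    show "c *s x \<in> S" if "x \<in> S" for c x
      using that B by (auto simp: S_def cmat_scale_mult_vec[symmetric] intro: star_algebraD)
  qed blast
  \<comment> \<open>Invariance of the range of \<open>u\<close> under \<open>B\<close> is one half
    of commutation; the other half is the same relation for \<open>b\<^sup>\<dagger>\<close>, after
    taking adjoints.\<close>
  have ubu: "b ** u = u ** b ** u" if b: "b \<in> B" for b
  proof -
    have "(b ** u) *v x = (u ** b ** u) *v x" for x
    proof -
      obtain b' where b': "b' \<in> B" "u *v x = b' *v v"
        using u(2)[of x] by (auto simp: S_def)
      have "b *v (u *v x) \<in> S"
        using b b' B by (auto simp: S_def matrix_vector_mul_assoc intro: star_algebraD)
      then show ?thesis
        using u(3) by (simp add: matrix_vector_mul_assoc[symmetric])
    qed
    then show ?thesis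
      by (simp add: matrix_eq)
  qed
  have "b ** u = u ** b" if b: "b \<in> B" for b
  proof -
    have "b\<^sup>\<dagger> \<in> B"
      using B b by (intro star_algebraD)
    then have "(b\<^sup>\<dagger> ** u)\<^sup>\<dagger> = (u ** b\<^sup>\<dagger> ** u)\<^sup>\<dagger>"
      using ubu by metis
    then have "u ** b = u ** b ** u"
      by (simp add: projectionD[OF u(1)] matrix_mul_assoc)
    then show ?thesis
      using ubu[OF b] by simp
  qed
  then have uc: "u \<in> commutant B"
    by (simp add: commutant_def)
  have vS: "v \<in> S"
    unfolding S_def using B by (intro image_eqI[of _ _ unit_cmat]) auto
  then have "u \<noteq> 0"
    using u(3) v by force
  show thesis
  proof (cases "u = unit_cmat")
    case False
    then show thesis
      using that u uc \<open>u \<noteq> 0\<close> by blast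
  next
    case True
    then have SU: "x \<in> S" for x
      using u(2)[of x] by simp
    have "e - outer v v = 0"
    proof -
      have pf: "projection (e - outer v v)"
        using pe v by (intro projection_diff projection_outer) (auto simp: mult_outer)
      have fe: "(e - outer v v) ** e = e - outer v v"
        using pe v by (simp add: cmat_distribs projectionD outer_mult)
      have fv: "(e - outer v v) *v v = 0"
        using v by (simp add: matrix_vector_mult_diff_rdistrib outer_mult_vec cinner_self)
      have "(e - outer v v) *v x = 0" for x
      proof -
        obtain b where b: "b \<in> B" "x = b *v v"
          using SU[of x] by (auto simp: S_def)
        obtain c where c: "e ** b ** e = cmat_scale c e"
          using minimal_projection_corner[OF B(1) e b(1)] by blast
        have "e *v x = (e ** b ** e) *v v"
          by (simp add: b v matrix_vector_mul_assoc[symmetric])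
        also have "\<dots> = c *s v"
          by (simp add: c cmat_scale_mult_vec v)
        finally have ex: "e *v x = c *s v" .
        have "(e - outer v v) *v x = (e - outer v v) *v (e *v x)"
          by (simp only: matrix_vector_mul_assoc fe)
        also have "\<dots> = c *s ((e - outer v v) *v v)"
          by (simp add: ex vector_scalar_commute)
        finally show ?thesis
          by (simp add: fv)
      qed
      then show ?thesis
        by (metis cmat_nonzero_vector)
    qed
    then have vB: "outer v v \<in> B"
      using pe by simp
    have "outer x y \<in> B" for x y
    proof -
      obtain b b' where b: "b \<in> B" "x = b *v v" "b' \<in> B" "y = b' *v v"
        using SU[of x] SU[of y] by (auto simp: S_def)
      have "outer x y = b ** outer v v ** b'\<^sup>\<dagger>"
        by (simp add: b mult_outer outer_mult)
      then show ?thesis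
        using b vB B by (simp add: star_algebraD)
    qed
    then have "X \<in> B" for X
      by (subst cmat_eq_sum_outer) (intro cmat.subspace_sum star_algebraD B)
    then show thesis
      using B(3) by blast
  qed
qed

text \<open>The elements of \<open>B\<close> annihilated by \<open>e\<close> form a two-sided star
  ideal. Its unit is central in \<open>B\<close>, hence a scalar, and this scalar annihilates
  \<open>e\<close> \<noteq> 0; so it is 0 and the ideal is trivial.\<close>

lemma factor_cut_faithful:
  fixes B :: "(complex^'n^'n) set"
  assumes B: "star_algebra B" "center B \<subseteq> scalar_matrices"
    and e: "e \<in> commutant B" "e \<noteq> 0" and b: "b \<in> B" "b ** e = 0"
  shows "b = 0"
proof -
  define J where "J = {x \<in> B. x ** e = 0}"
  have ce: "X ** e = e ** X" if "X \<in> B" for X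
    using e that by (simp add: commutant_def)
  have mult: "x ** y \<in> J" "y ** x \<in> J" if "x \<in> J" "y \<in> B" for x y
  proof -
    have "x ** y ** e = x ** e ** y"
      using ce[OF that(2)] by (simp add: matrix_mul_assoc[symmetric])
    then show "x ** y \<in> J"
      using that B by (simp add: J_def star_algebraD)
    have "y ** x ** e = y ** (x ** e)"
      by (simp add: matrix_mul_assoc)
    then show "y ** x \<in> J"
      using that B by (simp add: J_def star_algebraD)
  qed
  have adj: "x\<^sup>\<dagger> \<in> J" if "x \<in> J" for x
  proof -
    have x: "x \<in> B" "x ** e = 0"
      using that by (auto simp: J_def)
    have xB: "x\<^sup>\<dagger> \<in> B"
      using x B by (intro star_algebraD)
    have "(x\<^sup>\<dagger> ** e)\<^sup>\<dagger> ** (x\<^sup>\<dagger> ** e) = e\<^sup>\<dagger> ** (x ** x\<^sup>\<dagger> ** e)"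
      by (simp add: matrix_mul_assoc)
    also have "x ** x\<^sup>\<dagger> ** e = x ** e ** x\<^sup>\<dagger>"
      using ce[OF xB] by (simp add: matrix_mul_assoc[symmetric])
    finally have "(x\<^sup>\<dagger> ** e)\<^sup>\<dagger> ** (x\<^sup>\<dagger> ** e) = 0"
      by (simp add: x)
    then have "x\<^sup>\<dagger> ** e = 0"
      by (rule adjoint_mult_eq_zero)
    then show ?thesis
      using xB by (simp add: J_def)
  qed
  have J: "star_algebra J"
    using B mult adj
    by (intro star_algebraI) (auto simp: J_def star_algebraD cmat_distribs)
  obtain u where u: "u \<in> J" "projection u" "\<And>X. X \<in> J \<Longrightarrow> u ** X = X" "\<And>X. X \<in> J \<Longrightarrow> X ** u = X"
    using star_algebra_unit[OF J] by metis
  have "u ** X = X ** u" if "X \<in> B" for X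
    using u(3)[OF mult(2)[OF u(1) that]] u(4)[OF mult(1)[OF u(1) that]]
    by (simp add: matrix_mul_assoc)
  then have "u \<in> center B"
    using u(1) by (auto simp: center_def J_def)
  then obtain c where c: "u = cmat_scale c unit_cmat"
    using B(2) by (auto simp: scalar_matrices_eq)
  have "u ** e = 0"
    using u(1) by (simp add: J_def)
  then have "cmat_scale c e = 0"
    by (simp add: c)
  then have "c = 0"
    using e(2) by (simp add: cmat.scale_eq_0_iff)
  then have "u = 0"
    by (simp add: c)
  moreover have "b \<in> J"
    using b by (simp add: J_def)
  ultimately show ?thesis
    using u(3)[of b] by simp
qed

lemma center_subset_scalar_matrices:
  fixes B :: "(complex^'n^'n) set"
  assumes "unit_cmat \<in> B" "center_dim B = 1"
  shows "center B \<subseteq> scalar_matrices"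
proof -
  obtain Bs where Bs: "Bs \<subseteq> center B" "center B \<subseteq> cmat.span Bs" "card Bs = center_dim B"
    by (rule cmat.basis_exists[of "center B"])
  then obtain b where b: "Bs = {b}"
    using assms(2) by (auto simp: card_Suc_eq)
  have span: "\<exists>k. X = cmat_scale k b" if "X \<in> center B" for X
    using that Bs(2) by (auto simp: b cmat.span_singleton)
  have "unit_cmat \<in> center B"
    using assms(1) by (simp add: center_def)
  then obtain k where k: "unit_cmat = cmat_scale k b"
    using span by blast
  then have "k \<noteq> 0"
    by (metis cmat.scale_zero_left unit_cmat_nonzero)
  then have kb: "b = cmat_scale (inverse k) unit_cmat"
    by (simp add: k)
  show ?thesis
    using span unfolding kb by (auto simp: scalar_matrices_eq)
qed

section \<open>Dimensions of corners\<close>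

text \<open>The trace of an orthogonal projection is the dimension of its range. This turns
  dimensions of corners into products of matrix traces.\<close>

lemma dim_eq_sum_Basis:
  fixes P :: "'a::euclidean_space \<Rightarrow> 'a"
  assumes S: "Real_Vector_Spaces.subspace S"
    and P: "\<And>x. P x \<in> S" "\<And>x. x \<in> S \<Longrightarrow> P x = x" "\<And>x y. P x \<bullet> y = x \<bullet> P y"
  shows "(\<Sum>b\<in>Basis. P b \<bullet> b) = real (dim S)"
proof -
  obtain C where C: "C \<subseteq> S" "pairwise real_inner_class.orthogonal C" "\<And>x. x \<in> C \<Longrightarrow> norm x = 1"
      "independent C" "card C = dim S" "span C = S"
    using orthonormal_basis_subspace[OF S] by blast
  have fin: "finite C"
    using C(4) by (rule independent_imp_finite)
  have Pb: "P b \<bullet> b = (\<Sum>s\<in>C. (s \<bullet> b) * (s \<bullet> b))" for b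
  proof -
    have "P b = (\<Sum>s\<in>C. (P b \<bullet> s) *\<^sub>R s)"
      using orthonormal_basis_expand[OF C(2,3), of "P b"] fin P(1)[of b] C(6) by auto
    also have "\<dots> = (\<Sum>s\<in>C. (b \<bullet> s) *\<^sub>R s)"
      using C(1) P by (intro sum.cong) (auto simp: P(2)[OF subsetD[OF C(1)]])
    finally have "P b \<bullet> b = (\<Sum>s\<in>C. (b \<bullet> s) *\<^sub>R s) \<bullet> b"
      by simp
    also have "\<dots> = (\<Sum>s\<in>C. (s \<bullet> b) * (s \<bullet> b))"
      by (subst inner_sum_left) (simp add: inner_commute)
    finally show ?thesis .
  qed
  have "(\<Sum>b\<in>Basis. P b \<bullet> b) = (\<Sum>s\<in>C. \<Sum>b\<in>Basis. (s \<bullet> b) * (s \<bullet> b))"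
    unfolding Pb by (rule sum.swap)
  also have "\<dots> = (\<Sum>s\<in>C. 1)"
    using C(3) by (intro sum.cong) (auto simp: euclidean_inner[symmetric] dot_square_norm)
  finally show ?thesis
    using C(5) by simp
qed

lemma sum_Basis_vec:
  fixes f :: "('a::euclidean_space)^'n \<Rightarrow> 'b::comm_monoid_add"
  shows "(\<Sum>b\<in>Basis. f b) = (\<Sum>i\<in>UNIV. \<Sum>u\<in>Basis. f (axis i u))"
proof -
  have inj: "inj_on (\<lambda>(i, u). axis i u :: 'a^'n) (UNIV \<times> Basis)"
  proof (rule inj_onI, clarify)
    fix i j and u v :: 'a
    assume "u \<in> Basis" "v \<in> Basis" "(axis i u :: 'a^'n) = axis j v"
    moreover have "u \<noteq> 0"
      using \<open>u \<in> Basis\<close> nonzero_Basis by auto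
    ultimately show "i = j \<and> u = v"
      by (auto simp: axis_eq_axis)
  qed
  have "(\<Sum>b\<in>Basis. f b) = sum f ((\<lambda>(i, u). axis i u) ` (UNIV \<times> Basis))"
    by (rule sum.cong) (auto simp: Basis_vec_def)
  also have "\<dots> = (\<Sum>(i, u)\<in>UNIV \<times> Basis. f (axis i u))"
    by (subst sum.reindex[OF inj]) (auto simp: case_prod_unfold)
  also have "\<dots> = (\<Sum>i\<in>UNIV. \<Sum>u\<in>Basis. f (axis i u))"
    by (simp add: sum.cartesian_product)
  finally show ?thesis .
qed

lemma hermitian_trace: "p\<^sup>\<dagger> = p \<Longrightarrow> trace p = complex_of_real (rtrace p)"
proof -
  assume p: "p\<^sup>\<dagger> = p"
  have "cnj (trace p) = trace (p\<^sup>\<dagger>)"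
    by (simp add: trace_def)
  then have "cnj (trace p) = trace p"
    by (simp add: p)
  then show ?thesis
    by (simp add: rtrace_def complex_eq_iff)
qed

text \<open>The trace of X \<mapsto> p X q as a complex linear map is the product of the traces of
  \<open>p\<close> and \<open>q\<close>; the factor 2 is the passage to the trace of a real linear
  map.\<close>

lemma sum_Basis_corner:
  fixes p q :: "complex^'n^'n"
  assumes "p\<^sup>\<dagger> = p" "q\<^sup>\<dagger> = q"
  shows "(\<Sum>b\<in>Basis. (p ** b ** q) \<bullet> b) = 2 * rtrace p * rtrace q"
proof -
  have ax: "axis i (axis j c) = cmat_scale c (outer (axis i 1) (axis j 1))" for i j :: 'n and c
    by (rule cmat_eqI) (simp add: axis_def)
  have nth: "(p ** axis i (axis j c) ** q) $ i $ j = c * (p $ i $ i * q $ j $ j)" for i j c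
  proof -
    have q: "cnj (q $ k $ j) = q $ j $ k" for k
      using assms(2) by (metis adjoint_nth)
    have "(p *v axis i 1) $ i = p $ i $ i"
      by (simp add: matrix_vector_mult_def axis_def if_distrib cong: if_cong)
    moreover have "(q *v axis j 1) $ j = q $ j $ j"
      by (simp add: matrix_vector_mult_def axis_def if_distrib cong: if_cong)
    ultimately show ?thesis
      by (simp add: ax mult_outer outer_mult assms(2) q)
  qed
  have "(\<Sum>b\<in>Basis. (p ** b ** q) \<bullet> b)
      = (\<Sum>i\<in>UNIV. \<Sum>j\<in>UNIV. \<Sum>c\<in>{1, \<i>}. (c * (p $ i $ i * q $ j $ j)) \<bullet> c)"
    by (simp add: sum_Basis_vec inner_axis nth Basis_complex_def)
  also have "\<dots> = (\<Sum>i\<in>UNIV. \<Sum>j\<in>UNIV. 2 * Re (p $ i $ i * q $ j $ j))"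
    by (intro sum.cong refl) (simp add: inner_complex_def complex_eq_iff)
  also have "\<dots> = 2 * Re (trace p * trace q)"
    unfolding trace_def sum_product by (simp only: Re_sum sum_distrib_left)
  also have "\<dots> = 2 * rtrace p * rtrace q"
    using assms by (simp add: hermitian_trace)
  finally show ?thesis .
qed

lemma linear_corner: "linear (\<lambda>X. p ** X ** q)" for p q :: "complex^'n^'n"
  by (rule linearI) (simp_all add: cmat_distribs scaleR_eq_scale)

lemma inner_corner: "(p ** X ** q) \<bullet> Y = X \<bullet> (p\<^sup>\<dagger> ** Y ** q\<^sup>\<dagger>)" for p q :: "complex^'n^'n"
proof -
  have "(p ** X ** q) \<bullet> Y = rtrace (p ** (X ** q ** Y\<^sup>\<dagger>))"
    by (simp add: inner_cmat_eq_rtrace matrix_mul_assoc)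
  also have "\<dots> = rtrace (X ** q ** Y\<^sup>\<dagger> ** p)"
    by (rule rtrace_commute)
  also have "\<dots> = X \<bullet> (p\<^sup>\<dagger> ** Y ** q\<^sup>\<dagger>)"
    by (simp add: inner_cmat_eq_rtrace matrix_mul_assoc)
  finally show ?thesis .
qed

text \<open>Orthogonality of the \<open>p i\<close> kills the mixed terms, so X \<mapsto> \<Sum> p_i
  X q_i is itself an orthogonal projection for the Hilbert-Schmidt product, and its trace is
  additive in i.\<close>

lemma dim_sum_corners:
  fixes p q :: "'b \<Rightarrow> complex^'n^'n"
  assumes "finite I" and p: "\<And>i. i \<in> I \<Longrightarrow> projection (p i)" and q: "\<And>i. i \<in> I \<Longrightarrow> projection (q i)"
    and orth: "\<And>i j. i \<in> I \<Longrightarrow> j \<in> I \<Longrightarrow> i \<noteq> j \<Longrightarrow> p i ** p j = 0"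
  shows "Real_Vector_Spaces.subspace (range (\<lambda>X. \<Sum>i\<in>I. p i ** X ** q i))"
    and "real (dim (range (\<lambda>X. \<Sum>i\<in>I. p i ** X ** q i))) = 2 * (\<Sum>i\<in>I. rtrace (p i) * rtrace (q i))"
proof -
  define P where "P X = (\<Sum>i\<in>I. p i ** X ** q i)" for X
  have lin: "linear P"
    unfolding P_def by (intro linear_compose_sum ballI linear_corner)
  show sub: "Real_Vector_Spaces.subspace (range (\<lambda>X. \<Sum>i\<in>I. p i ** X ** q i))"
    using lin unfolding P_def by (rule linear_subspace_image) simp
  have "P (P X) = P X" for X
  proof -
    have "p i ** P X ** q i = p i ** X ** q i" if i: "i \<in> I" for i
    proof -
      have "p i ** P X ** q i = (\<Sum>j\<in>I. p i ** p j ** X ** q j ** q i)"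
        by (simp add: P_def cmat_sum_mult cmat_mult_sum matrix_mul_assoc)
      also have "\<dots> = (\<Sum>j\<in>I. if j = i then p i ** X ** q i else 0)"
      proof (intro sum.cong refl)
        fix j assume "j \<in> I"
        then show "p i ** p j ** X ** q j ** q i = (if j = i then p i ** X ** q i else 0)"
          using orth[of i j] i p[OF i] q[OF i]
          by (auto simp: projectionD) (simp add: projectionD matrix_mul_assoc[symmetric])
      qed
      finally show ?thesis
        using i \<open>finite I\<close> by simp
    qed
    then show ?thesis
      by (simp add: P_def)
  qed
  moreover have "P X \<bullet> Y = X \<bullet> P Y" for X Y
    using p q by (simp add: P_def inner_sum_left inner_sum_right inner_corner projectionD cong: sum.cong)
  ultimately have "real (dim (range P)) = (\<Sum>b\<in>Basis. P b \<bullet> b)"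
    using sub by (intro dim_eq_sum_Basis[symmetric]) (auto simp: P_def)
  also have "\<dots> = (\<Sum>i\<in>I. \<Sum>b\<in>Basis. (p i ** b ** q i) \<bullet> b)"
    unfolding P_def inner_sum_left by (rule sum.swap)
  also have "\<dots> = (\<Sum>i\<in>I. 2 * rtrace (p i) * rtrace (q i))"
    using p q by (intro sum.cong refl sum_Basis_corner) (auto simp: projectionD)
  finally show "real (dim (range (\<lambda>X. \<Sum>i\<in>I. p i ** X ** q i))) = 2 * (\<Sum>i\<in>I. rtrace (p i) * rtrace (q i))"
    by (simp add: P_def[abs_def] sum_distrib_left mult_ac)
qed

lemma dim_corner:
  fixes p q :: "complex^'n^'n"
  assumes "projection p" "projection q"
  shows "real (dim (range (\<lambda>X. p ** X ** q))) = 2 * rtrace p * rtrace q"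
  using dim_sum_corners(2)[of "{()}" "\<lambda>_. p" "\<lambda>_. q"] assms by simp

lemma rtrace_compl: "rtrace (unit_cmat - p :: complex^'n^'n) = real CARD('n) - rtrace p"
  by (simp add: rtrace_diff rtrace_unit)

section \<open>Corners of proper factors\<close>

lemma commutant_compl: "e \<in> commutant B \<Longrightarrow> unit_cmat - e \<in> commutant B"
  by (simp add: commutant_def cmat_distribs)

lemma projection_commutant_mult:
  assumes "projection p" "projection e" "p \<in> B" "e \<in> commutant B"
  shows "projection (p ** e)" "projection (e ** (unit_cmat - p))"
    "rtrace (p ** e) + rtrace (e ** (unit_cmat - p)) = rtrace e"
proof -
  have c: "p ** e = e ** p"
    using assms by (simp add: commutant_def)
  show "projection (p ** e)"
    using assms c by (intro projection_mult)
  show "projection (e ** (unit_cmat - p))"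
    using assms c by (intro projection_mult projection_compl) (simp_all add: cmat_distribs)
  show "rtrace (p ** e) + rtrace (e ** (unit_cmat - p)) = rtrace e"
    by (simp add: c cmat_distribs rtrace_diff)
qed

text \<open>In (a + c) (b + d) the terms a b and c d are at least m each, and a d + c b is at least
  2 m by the inequality of arithmetic and geometric means, as m^2 \<le> (a d) (c b).\<close>

lemma quarter_bound:
  fixes a b c d m :: real
  assumes "0 \<le> a" "0 \<le> b" "0 \<le> c" "0 \<le> d" "0 \<le> m" "m \<le> a * b" "m \<le> c * d"
  shows "4 * m \<le> (a + c) * (b + d)"
proof -
  have "m * m \<le> (a * b) * (c * d)"
    using assms by (intro mult_mono) auto
  moreover have "(a * d + c * b)^2 = (a * d - c * b)^2 + 4 * ((a * b) * (c * d))"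
    by (simp add: power2_eq_square algebra_simps)
  ultimately have "(2 * m)^2 \<le> (a * d + c * b)^2"
    using zero_le_power2[of "a * d - c * b"] unfolding power2_eq_square by linarith
  then have "2 * m \<le> a * d + c * b"
    using assms by (intro power2_le_imp_le[of "2 * m"]) auto
  then show ?thesis
    using assms by (simp add: algebra_simps)
qed

text \<open>Right multiplication by a nonzero projection of the commutant is injective on a factor.
  Applied to \<open>e\<close> and to its complement, it embeds the corner into two corners of the
  full matrix algebra, whose sides add up to the ranks of \<open>p\<close> and of
  \<open>unit_cmat - p\<close>.\<close>

lemma factor_corner_bound:
  fixes B :: "(complex^'n^'n) set"
  assumes B: "star_algebra B" "unit_cmat \<in> B" "B \<noteq> UNIV" "center B \<subseteq> scalar_matrices"
    and p: "projection p" "p \<in> B"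
  shows "real (dim ((\<lambda>X. p ** X ** (unit_cmat - p)) ` B)) \<le> rtrace p * (real CARD('n) - rtrace p) / 2"
proof -
  define S where "S = (\<lambda>X. p ** X ** (unit_cmat - p)) ` B"
  have SB: "S \<subseteq> B"
    using B p by (auto simp: S_def intro!: star_algebraD)
  have subS: "Real_Vector_Spaces.subspace S"
    unfolding S_def
    by (intro linear_subspace_image[OF linear_corner] cmat_subspace_imp_subspace star_algebraD B)
  obtain e where e: "projection e" "e \<in> commutant B" "e \<noteq> 0" "e \<noteq> unit_cmat"
    using commutant_projection[OF B(1-3)] by blast
  have cut: "real (dim S) \<le> 2 * (rtrace (p ** e) * rtrace (e ** (unit_cmat - p)))"
    if e: "projection e" "e \<in> commutant B" "e \<noteq> 0" for e
  proof -
    have lin: "linear (\<lambda>X :: complex^'n^'n. X ** e)"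
      using linear_corner[of unit_cmat e] by simp
    have "inj_on (\<lambda>X. X ** e) (span S)"
      unfolding span_eq_iff[THEN iffD2, OF subS]
      by (subst linear_inj_on_iff_eq_0[OF lin subS])
        (use factor_cut_faithful[OF B(1,4) e(2,3)] SB in auto)
    then have "dim S = dim ((\<lambda>X. X ** e) ` S)"
      by (rule dim_image_eq[OF lin, symmetric])
    also have "\<dots> \<le> dim (range (\<lambda>X. (p ** e) ** X ** (e ** (unit_cmat - p))))"
    proof (rule dim_subset, clarify)
      fix Y assume "Y \<in> S"
      then obtain X where X: "X \<in> B" "Y = p ** X ** (unit_cmat - p)"
        by (auto simp: S_def)
      have "(unit_cmat - p) ** e = e ** (unit_cmat - p)" "X ** e = e ** X"
        using e p X by (auto simp: commutant_def cmat_distribs)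
      then have "Y ** e = p ** (e ** e) ** X ** (e ** (unit_cmat - p))"
        using e(1) X(2) by (metis matrix_mul_assoc projectionD(2))
      then show "Y ** e \<in> range (\<lambda>X. (p ** e) ** X ** (e ** (unit_cmat - p)))"
        using e(1) by (auto simp: projectionD)
    qed
    finally show ?thesis
      using dim_corner[OF projection_commutant_mult(1,2)[OF p(1) e(1) p(2) e(2)]] by simp
  qed
  define a b c d where "a = rtrace (p ** e)" and "b = rtrace (e ** (unit_cmat - p))"
    and "c = rtrace (p ** (unit_cmat - e))" and "d = rtrace ((unit_cmat - e) ** (unit_cmat - p))"
  have ce: "projection (unit_cmat - e)" "unit_cmat - e \<in> commutant B" "unit_cmat - e \<noteq> 0"
    using e by (auto intro: projection_compl commutant_compl)
  have sums: "a + c = rtrace p" "b + d = real CARD('n) - rtrace p"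
    by (simp_all add: a_def b_def c_def d_def cmat_distribs rtrace_diff rtrace_unit)
  \<comment> \<open>Half the real dimension is the complex dimension; this is why the final bound is
    a half and not a quarter of r (N - r).\<close>
  have "4 * (real (dim S) / 2) \<le> (a + c) * (b + d)"
    using cut[OF e(1-3)] cut[OF ce]
      projection_commutant_mult(1,2)[OF p(1) e(1) p(2) e(2), THEN projection_rtrace_nonneg]
      projection_commutant_mult(1,2)[OF p(1) ce(1) p(2) ce(2), THEN projection_rtrace_nonneg]
    by (intro quarter_bound) (auto simp: a_def b_def c_def d_def)
  then show ?thesis
    by (simp add: sums S_def)
qed

section \<open>Corners of algebras with several blocks\<close>

lemma corner_subset_sum_corners:
  fixes B :: "(complex^'n^'n) set"
  assumes z: "finite I" "\<And>i. i \<in> I \<Longrightarrow> projection (z i)" "\<And>i. i \<in> I \<Longrightarrow> z i \<in> commutant B"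
      "(\<Sum>i\<in>I. z i) = unit_cmat"
    and X: "X \<in> B"
  shows "p ** X ** (unit_cmat - p) = (\<Sum>i\<in>I. (p ** z i) ** X ** (z i ** (unit_cmat - p)))"
proof -
  have "(p ** z i) ** X ** (z i ** (unit_cmat - p)) = p ** z i ** (X ** (unit_cmat - p))" if i: "i \<in> I" for i
  proof -
    have "X ** z i = z i ** X"
      using z(3)[OF i] X by (simp add: commutant_def)
    then show ?thesis
      using projectionD(2)[OF z(2)[OF i]] by (metis matrix_mul_assoc)
  qed
  then have "(\<Sum>i\<in>I. (p ** z i) ** X ** (z i ** (unit_cmat - p))) = p ** (\<Sum>i\<in>I. z i) ** (X ** (unit_cmat - p))"
    by (simp add: cmat_mult_sum cmat_sum_mult)
  then show ?thesis
    by (simp add: z(4) matrix_mul_assoc)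
qed

text \<open>Elements of \<open>B\<close> are block diagonal for the \<open>z i\<close>, so their
  corners live in the sum of the block corners. With r_i the rank of \<open>p\<close> in block i,
  that sum has complex dimension \<Sum> r_i (rank z_i - r_i).\<close>

lemma central_corner_bound:
  fixes B :: "(complex^'n^'n) set"
  assumes z: "finite I" "\<And>i. i \<in> I \<Longrightarrow> projection (z i)" "\<And>i. i \<in> I \<Longrightarrow> z i \<in> commutant B"
      "(\<Sum>i\<in>I. z i) = unit_cmat" "\<And>i j. i \<in> I \<Longrightarrow> j \<in> I \<Longrightarrow> i \<noteq> j \<Longrightarrow> z i ** z j = 0"
    and p: "projection p" "p \<in> B"
  shows "Real_Vector_Spaces.subspace (range (\<lambda>X. \<Sum>i\<in>I. (p ** z i) ** X ** (z i ** (unit_cmat - p))))"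
    and "(\<lambda>X. p ** X ** (unit_cmat - p)) ` B \<subseteq> range (\<lambda>X. \<Sum>i\<in>I. (p ** z i) ** X ** (z i ** (unit_cmat - p)))"
    and "real (dim (range (\<lambda>X. \<Sum>i\<in>I. (p ** z i) ** X ** (z i ** (unit_cmat - p)))))
      = 2 * (\<Sum>i\<in>I. rtrace (p ** z i) * (rtrace (z i) - rtrace (p ** z i)))"
proof -
  have orth: "p ** z i ** (p ** z j) = 0" if "i \<in> I" "j \<in> I" "i \<noteq> j" for i j
  proof -
    have "p ** z i ** (p ** z j) = p ** p ** (z i ** z j)"
      using z(3)[OF that(1)] p(2) by (simp add: commutant_def matrix_mul_assoc) (metis matrix_mul_assoc)
    then show ?thesis
      using z(5)[OF that] by simp
  qed
  note pr = projection_commutant_mult[OF p(1) z(2) p(2) z(3)]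
  show "Real_Vector_Spaces.subspace (range (\<lambda>X. \<Sum>i\<in>I. (p ** z i) ** X ** (z i ** (unit_cmat - p))))"
    using z(1) pr(1,2) orth by (rule dim_sum_corners)
  show "(\<lambda>X. p ** X ** (unit_cmat - p)) ` B \<subseteq> range (\<lambda>X. \<Sum>i\<in>I. (p ** z i) ** X ** (z i ** (unit_cmat - p)))"
    using corner_subset_sum_corners[OF z(1-4)] by auto
  have "real (dim (range (\<lambda>X. \<Sum>i\<in>I. (p ** z i) ** X ** (z i ** (unit_cmat - p)))))
      = 2 * (\<Sum>i\<in>I. rtrace (p ** z i) * rtrace (z i ** (unit_cmat - p)))"
    using z(1) pr(1,2) orth by (rule dim_sum_corners)
  also have "(\<Sum>i\<in>I. rtrace (p ** z i) * rtrace (z i ** (unit_cmat - p)))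
      = (\<Sum>i\<in>I. rtrace (p ** z i) * (rtrace (z i) - rtrace (p ** z i)))"
    using pr(3) by (intro sum.cong refl) (simp add: algebra_simps flip: pr(3))
  finally show "real (dim (range (\<lambda>X. \<Sum>i\<in>I. (p ** z i) ** X ** (z i ** (unit_cmat - p)))))
      = 2 * (\<Sum>i\<in>I. rtrace (p ** z i) * (rtrace (z i) - rtrace (p ** z i)))" .
qed

text \<open>With r_i the rank of \<open>p\<close> in block i and K = N/d, the block count is \<Sum>
  r_i (K - r_i) = r K - \<Sum> r_i^2, and Cauchy-Schwarz gives \<Sum> r_i^2 \<ge> r^2 / d.\<close>

lemma equal_blocks_corner_bound:
  fixes B :: "(complex^'n^'n) set"
  assumes z: "finite I" "\<And>i. i \<in> I \<Longrightarrow> projection (z i)" "\<And>i. i \<in> I \<Longrightarrow> z i \<in> commutant B"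
      "(\<Sum>i\<in>I. z i) = unit_cmat" "\<And>i j. i \<in> I \<Longrightarrow> j \<in> I \<Longrightarrow> i \<noteq> j \<Longrightarrow> z i ** z j = 0"
    and tr: "\<And>i. i \<in> I \<Longrightarrow> rtrace (z i) = real CARD('n) / real (card I)"
    and p: "projection p" "p \<in> B"
  shows "real (dim ((\<lambda>X. p ** X ** (unit_cmat - p)) ` B)) \<le> 2 * rtrace p * (real CARD('n) - rtrace p) / real (card I)"
proof -
  define r where "r i = rtrace (p ** z i)" for i
  define K where "K = real CARD('n) / real (card I)"
  have "I \<noteq> {}"
    using z(4) by (auto dest: sym)
  then have cI: "card I > 0"
    using z(1) by (simp add: card_gt_0_iff)
  have sumr: "(\<Sum>i\<in>I. r i) = rtrace p"
    using z(4) by (simp add: r_def flip: rtrace_sum cmat_mult_sum)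
  have CS: "(rtrace p)^2 \<le> (\<Sum>i\<in>I. (r i)^2) * real (card I)"
    using Cauchy_Schwarz_ineq_sum[of r "\<lambda>_. 1" I] by (simp add: sumr)
  have "real (dim ((\<lambda>X. p ** X ** (unit_cmat - p)) ` B)) \<le> 2 * (\<Sum>i\<in>I. r i * (rtrace (z i) - r i))"
    using dim_subset[OF central_corner_bound(2)[OF z p]] central_corner_bound(3)[OF z p]
    by (simp add: r_def)
  also have "(\<Sum>i\<in>I. r i * (rtrace (z i) - r i)) = (\<Sum>i\<in>I. r i * K - (r i)^2)"
    by (intro sum.cong refl) (simp add: tr K_def power2_eq_square algebra_simps)
  also have "\<dots> = rtrace p * K - (\<Sum>i\<in>I. (r i)^2)"
    by (simp add: sum_subtractf sumr flip: sum_distrib_right)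
  also have "2 * \<dots> \<le> 2 * rtrace p * (real CARD('n) - rtrace p) / real (card I)"
    using CS cI by (simp add: K_def field_simps power2_eq_square)
  finally show ?thesis
    by simp
qed

text \<open>Adjoints of p M q give q M p, and products of the two off-diagonal corners give the
  diagonal corners, since neither projection is 0.\<close>

lemma full_corner_imp_full_blocks:
  fixes B :: "(complex^'n^'n) set"
  assumes B: "star_algebra B" and p: "projection p" "projection q" "p \<noteq> 0" "q \<noteq> 0"
    and pq: "\<And>X. p ** X ** q \<in> B"
  shows "(p + q) ** X ** (p + q) \<in> B"
proof -
  have qp: "q ** X ** p \<in> B" for X
  proof -
    have "(p ** X\<^sup>\<dagger> ** q)\<^sup>\<dagger> \<in> B"
      using pq B by (blast intro: star_algebraD)
    then show ?thesis
      using p by (simp add: projectionD matrix_mul_assoc)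
  qed
  have diag: "e ** X ** e \<in> B"
    if e: "\<And>X. e ** X ** f \<in> B" "\<And>X. f ** X ** e \<in> B" "projection f" "f \<noteq> 0" for e f X
  proof -
    obtain y where y: "f *v y \<noteq> 0"
      using e(4) by (blast elim: cmat_nonzero_vector)
    \<comment> \<open>A unit vector in the range of \<open>f\<close> through which
      \<open>outer x z\<close> factors as \<open>outer x w ** outer w z\<close>.\<close>
    define w where "w = (1 / norm (f *v y)) *\<^sub>R (f *v y)"
    have w: "norm w = 1" "f *v w = w"
      using y e by (auto simp: w_def cmat_mult_scaleR_vec matrix_vector_mul_assoc projectionD)
    have "e ** outer x z ** e \<in> B" for x z
    proof -
      have "(e ** outer x w ** f) ** (f ** outer w z ** e) \<in> B"
        using e B by (blast intro: star_algebraD)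
      also have "(e ** outer x w ** f) ** (f ** outer w z ** e) = e ** (outer x w ** outer w z) ** e"
      proof -
        have "outer x w ** f = outer x w" "f ** outer w z = outer w z"
          using w e(3) by (simp_all add: outer_mult mult_outer projectionD)
        then show ?thesis
          by (metis matrix_mul_assoc)
      qed
      also have "outer x w ** outer w z = outer x z"
        by (simp add: outer_mult_outer cinner_self w)
      finally show ?thesis .
    qed
    then have "(\<Sum>i\<in>UNIV. \<Sum>j\<in>UNIV. cmat_scale (X $ i $ j) (e ** outer (axis i 1) (axis j 1) ** e)) \<in> B"
      by (intro cmat.subspace_sum[OF star_algebraD(1)[OF B]] star_algebraD(5)[OF B]) auto
    also have "(\<Sum>i\<in>UNIV. \<Sum>j\<in>UNIV. cmat_scale (X $ i $ j) (e ** outer (axis i 1) (axis j 1) ** e))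
        = e ** (\<Sum>i\<in>UNIV. \<Sum>j\<in>UNIV. cmat_scale (X $ i $ j) (outer (axis i 1) (axis j 1))) ** e"
      by (simp add: cmat_sum_mult cmat_mult_sum)
    finally show ?thesis
      by (simp flip: cmat_eq_sum_outer)
  qed
  have "p ** X ** p \<in> B" "q ** X ** q \<in> B"
    using diag[of p q X] diag[of q p X] pq qp p by auto
  then have "p ** X ** p + p ** X ** q + (q ** X ** p + q ** X ** q) \<in> B"
    using pq qp by (intro star_algebraD(3)[OF B]) auto
  then show ?thesis
    by (simp add: cmat_distribs add_ac)
qed

text \<open>The count over two blocks of size N/2 misses r (N - r) by (r1 - r2)^2, so only r1 = r2
  is critical. There, equality would make \<open>B\<close> contain the whole corner between
  \<open>p ** z2\<close> and its complement in \<open>z2\<close>, hence all of z2 M z2; but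
  \<open>f\<close> is minimal in \<open>B\<close> and has rank above 1.\<close>

lemma unequal_blocks_corner_bound:
  fixes B :: "(complex^'n^'n) set"
  assumes B: "star_algebra B" "unit_cmat \<in> B"
    and z: "projection z1" "projection z2" "z1 \<in> commutant B" "z2 \<in> commutant B" "z2 \<in> B"
      "z1 + z2 = unit_cmat" "z1 ** z2 = 0" "z2 ** z1 = 0"
    and tr: "rtrace z1 = real CARD('n) / 2" "rtrace z2 = real CARD('n) / 2"
    and f: "projection f" "f \<in> B" "z2 ** f = f" "rtrace f > 1"
      "\<And>X. X \<in> B \<Longrightarrow> \<exists>c. f ** X ** f = cmat_scale c f"
    and p: "projection p" "p \<in> B" "p \<noteq> 0" "p \<noteq> unit_cmat"
  shows "real (dim ((\<lambda>X. p ** X ** (unit_cmat - p)) ` B)) < rtrace p * (real CARD('n) - rtrace p)"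
proof -
  define z where "z b = (if b then z1 else z2)" for b :: bool
  have zz: "finite (UNIV :: bool set)" "\<And>i. projection (z i)" "\<And>i. z i \<in> commutant B"
      "(\<Sum>i\<in>UNIV. z i) = unit_cmat" "\<And>i j. i \<noteq> j \<Longrightarrow> z i ** z j = 0"
    using z by (auto simp: z_def UNIV_bool add.commute)
  define S where "S = (\<lambda>X. p ** X ** (unit_cmat - p)) ` B"
  define R where "R = range (\<lambda>X. \<Sum>i\<in>UNIV. (p ** z i) ** X ** (z i ** (unit_cmat - p)))"
  note cb = central_corner_bound[of UNIV z B p, OF zz(1) zz(2) zz(3) zz(4) zz(5) p(1,2)]
  define M where "M = real CARD('n) / 2"
  define r1 r2 where "r1 = rtrace (p ** z1)" and "r2 = rtrace (p ** z2)"
  have dimR: "real (dim R) = 2 * (r1 * (M - r1) + r2 * (M - r2))"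
    using cb(3) by (simp add: R_def UNIV_bool z_def tr M_def r1_def r2_def)
  have r: "r1 + r2 = rtrace p"
    by (simp add: r1_def r2_def z flip: rtrace_add cmat_mult_add)
  have SR: "S \<subseteq> R"
    using cb(2) by (simp add: S_def R_def)
  have subS: "Real_Vector_Spaces.subspace S"
    unfolding S_def
    by (intro linear_subspace_image[OF linear_corner] cmat_subspace_imp_subspace star_algebraD B)
  have SB: "S \<subseteq> B"
    using B p by (auto simp: S_def intro!: star_algebraD)
  have target: "rtrace p * (real CARD('n) - rtrace p) = 2 * (r1 * (M - r1) + r2 * (M - r2)) + (r1 - r2)^2"
    by (simp add: M_def flip: r) (simp add: power2_eq_square field_simps)
  have le: "dim S \<le> dim R"
    using SR by (rule dim_subset)
  show ?thesis
  proof (cases "r1 = r2")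
    case False
    then have "(r1 - r2)^2 > 0"
      by simp
    then show ?thesis
      using le target dimR unfolding S_def[symmetric] by linarith
  next
    case True
    have "dim S \<noteq> dim R"
    proof
      assume "dim S = dim R"
      then have SeqR: "S = R"
        using SR subS cb(1) by (intro subspace_dim_equal) (auto simp: R_def)
      define q where "q = z2 ** (unit_cmat - p)"
      note pr = projection_commutant_mult[OF p(1) z(2) p(2) z(4)]
      have c: "p ** z2 = z2 ** p"
        using p(2) z(4) by (simp add: commutant_def)
      \<comment> \<open>Both nonvanishing claims use r1 = r2: otherwise \<open>p\<close> would be 0
        in both blocks, or 1 in both blocks.\<close>
      have p0: "p ** z2 \<noteq> 0"
      proof
        assume "p ** z2 = 0"
        then have "rtrace p = 0"
          using r True by (simp add: r2_def)
        then show False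
          using projection_rtrace_pos[OF p(1,3)] by simp
      qed
      have q0: "q \<noteq> 0"
      proof
        assume "q = 0"
        then have "r2 = M"
          using pr(3) by (simp add: q_def r2_def tr M_def)
        then have "rtrace (unit_cmat - p) = 0"
          using r True by (simp add: rtrace_compl M_def)
        then show False
          using projection_rtrace_pos[OF projection_compl[OF p(1)]] p(4) by simp
      qed
      have "p ** z2 ** Y ** q \<in> B" for Y
      proof -
        \<comment> \<open>The matrix compressed to \<open>z2\<close> has no component in the block
          of \<open>z1\<close>, so a single summand survives and the corner of the second block is
          seen to lie in \<open>R\<close>.\<close>
        have "(\<Sum>i\<in>UNIV. (p ** z i) ** (z2 ** Y ** z2) ** (z i ** (unit_cmat - p))) = p ** z2 ** Y ** q"
        proof -
          have "p ** z1 ** (z2 ** Y ** z2) = 0"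
            using z(7) by (simp add: matrix_mul_assoc) (simp flip: matrix_mul_assoc)
          moreover have "p ** z2 ** (z2 ** Y ** z2) ** (z2 ** (unit_cmat - p)) = p ** z2 ** Y ** q"
          proof -
            have "p ** z2 ** (z2 ** Y ** z2) ** (z2 ** (unit_cmat - p))
                = p ** (z2 ** z2) ** Y ** ((z2 ** z2) ** (unit_cmat - p))"
              by (simp only: matrix_mul_assoc)
            then show ?thesis
              by (simp only: projectionD(2)[OF z(2)] q_def)
          qed
          ultimately show ?thesis
            by (simp add: UNIV_bool z_def)
        qed
        then have "p ** z2 ** Y ** q \<in> R"
          unfolding R_def by (rule range_eqI[OF sym])
        then show ?thesis
          using SeqR SB by blast
      qed
      then have "(p ** z2 + q) ** X ** (p ** z2 + q) \<in> B" for X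
        using pr(1,2) p0 q0 by (intro full_corner_imp_full_blocks[OF B(1)]) (auto simp: q_def)
      moreover have "p ** z2 + q = z2"
        by (simp add: q_def c cmat_distribs)
      ultimately have zXz: "z2 ** X ** z2 \<in> B" for X
        by simp
      have "\<exists>c. f ** X ** f = cmat_scale c f" for X
      proof -
        have "f ** z2 = f"
          using z(2) f by (intro subprojection_commute)
        then have "f ** X ** f = f ** (z2 ** X ** z2) ** f"
          using f(3) by (metis matrix_mul_assoc)
        then show ?thesis
          using f(5)[OF zXz] by metis
      qed
      \<comment> \<open>Over the reals f M f would be spanned by two elements, while its dimension
        is twice the square of the rank of \<open>f\<close>.\<close>
      then have "range (\<lambda>X. f ** X ** f) \<subseteq> span {f, cmat_scale \<i> f}"
      proof (intro subsetI, elim rangeE)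
        fix X Y assume "\<And>X. \<exists>c. f ** X ** f = cmat_scale c f" "Y = f ** X ** f"
        then obtain c where "Y = cmat_scale c f"
          by metis
        also have "\<dots> = Re c *\<^sub>R f + Im c *\<^sub>R cmat_scale \<i> f"
          by (rule cmat_eqI) (simp add: complex_eq_iff)
        also have "\<dots> \<in> span {f, cmat_scale \<i> f}"
          by (intro span_add span_scale span_base) auto
        finally show "Y \<in> span {f, cmat_scale \<i> f}" .
      qed
      then have "dim (range (\<lambda>X. f ** X ** f)) \<le> card {f, cmat_scale \<i> f}"
        by (intro dim_le_card) auto
      also have "\<dots> \<le> 2"
        by (simp add: card_insert_if)
      finally have "2 * rtrace f * rtrace f \<le> 2"
        using dim_corner[OF f(1) f(1)] by linarith
      moreover have "rtrace f * rtrace f > 1 * 1"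
        using f(4) by (intro mult_strict_mono) auto
      ultimately show False
        by simp
    qed
    then have "dim S < dim R"
      using le by simp
    then show ?thesis
      using target dimR True unfolding S_def[symmetric] by simp
  qed
qed

section \<open>Block decompositions\<close>

definition matrix_unit :: "nat \<Rightarrow> nat \<Rightarrow> nat \<Rightarrow> complex mat" where
  "matrix_unit k a b = Matrix.mat k k (\<lambda>(x, y). if x = a \<and> y = b then 1 else 0)"

lemma matrix_unit_carrier [simp]: "matrix_unit k a b \<in> carrier_mat k k"
  by (simp add: matrix_unit_def)

lemma index_matrix_unit [simp]:
  "x < k \<Longrightarrow> y < k \<Longrightarrow> matrix_unit k a b $$ (x, y) = (if x = a \<and> y = b then 1 else 0)"
  by (simp add: matrix_unit_def)

lemma index_mult_matrix_unit:
  assumes "A \<in> carrier_mat k k" "a < k" "x < k" "y < k"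
  shows "(A * matrix_unit k a b) $$ (x, y) = (if y = b then A $$ (x, a) else 0)"
proof -
  have "(A * matrix_unit k a b) $$ (x, y) = (\<Sum>l\<in>{0..<k}. A $$ (x, l) * matrix_unit k a b $$ (l, y))"
    using assms by (auto simp: scalar_prod_def matrix_unit_def intro!: sum.cong)
  also have "\<dots> = (\<Sum>l\<in>{0..<k}. if l = a then (if y = b then A $$ (x, l) else 0) else 0)"
    using assms by (intro sum.cong) auto
  finally show ?thesis
    using assms by simp
qed

lemma index_matrix_unit_mult:
  assumes "A \<in> carrier_mat k k" "b < k" "x < k" "y < k"
  shows "(matrix_unit k a b * A) $$ (x, y) = (if x = a then A $$ (b, y) else 0)"
proof -
  have "(matrix_unit k a b * A) $$ (x, y) = (\<Sum>l\<in>{0..<k}. matrix_unit k a b $$ (x, l) * A $$ (l, y))"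
    using assms by (auto simp: scalar_prod_def matrix_unit_def intro!: sum.cong)
  also have "\<dots> = (\<Sum>l\<in>{0..<k}. if l = b then (if x = a then A $$ (l, y) else 0) else 0)"
    using assms by (intro sum.cong) auto
  finally show ?thesis
    using assms by simp
qed

lemma matrix_unit_mult:
  assumes "a < k" "b < k" "c < k" "d < k"
  shows "matrix_unit k a b * matrix_unit k c d = (if b = c then matrix_unit k a d else 0\<^sub>m k k)"
proof (rule eq_matI)
  fix x y
  assume "x < dim_row (if b = c then matrix_unit k a d else 0\<^sub>m k k)"
    and "y < dim_col (if b = c then matrix_unit k a d else 0\<^sub>m k k)"
  then have "x < k" "y < k"
    by (auto simp: matrix_unit_def split: if_splits)
  then show "(matrix_unit k a b * matrix_unit k c d) $$ (x, y)
      = (if b = c then matrix_unit k a d else 0\<^sub>m k k) $$ (x, y)"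
    using assms index_matrix_unit_mult[of "matrix_unit k c d" k b x y a] by auto
qed (auto simp: matrix_unit_def)

lemma mat_adjoint_carrier:
  assumes "A \<in> carrier_mat k k"
  shows "mat_adjoint A \<in> carrier_mat k k"
  using assms by (auto simp: mat_adjoint_def mat_of_rows_def)

lemma index_mat_adjoint:
  assumes "A \<in> carrier_mat k k" "x < k" "y < k"
  shows "mat_adjoint A $$ (x, y) = cnj (A $$ (y, x))"
  using assms by (auto simp: mat_adjoint_def mat_of_rows_def)

lemma mat_adjoint_matrix_unit: "mat_adjoint (matrix_unit k a b) = matrix_unit k b a"
proof (rule eq_matI)
  fix x y
  assume "x < dim_row (matrix_unit k b a)" "y < dim_col (matrix_unit k b a)"
  then have "x < k" "y < k"
    by (simp_all add: matrix_unit_def)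
  then show "mat_adjoint (matrix_unit k a b) $$ (x, y) = matrix_unit k b a $$ (x, y)"
    by (simp add: index_mat_adjoint[OF matrix_unit_carrier])
qed (simp_all add: carrier_matD[OF mat_adjoint_carrier[OF matrix_unit_carrier]]
      carrier_matD[OF matrix_unit_carrier])

text \<open>The list-valued isomorphism is replaced by its coordinate maps \<open>c X i\<close>, so
  that equations in \<open>B\<close> can be checked block by block.\<close>

lemma star_isomorphism_components:
  fixes B :: "(complex^'n^'n) set"
  assumes iso: "star_isomorphic_direct_sum B ks" and B: "star_algebra B"
  obtains c :: "complex^'n^'n \<Rightarrow> nat \<Rightarrow> complex mat" where
    "\<And>X i. X \<in> B \<Longrightarrow> i < length ks \<Longrightarrow> c X i \<in> carrier_mat (ks ! i) (ks ! i)"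
    "\<And>X Y. X \<in> B \<Longrightarrow> Y \<in> B \<Longrightarrow> \<forall>i<length ks. c X i = c Y i \<Longrightarrow> X = Y"
    "\<And>M. \<forall>i<length ks. M i \<in> carrier_mat (ks ! i) (ks ! i) \<Longrightarrow>
       \<exists>X\<in>B. \<forall>i<length ks. c X i = M i"
    "\<And>X Y i. X \<in> B \<Longrightarrow> Y \<in> B \<Longrightarrow> i < length ks \<Longrightarrow> c (X + Y) i = c X i + c Y i"
    "\<And>a X i. X \<in> B \<Longrightarrow> i < length ks \<Longrightarrow> c (cmat_scale a X) i = a \<cdot>\<^sub>m c X i"
    "\<And>X Y i. X \<in> B \<Longrightarrow> Y \<in> B \<Longrightarrow> i < length ks \<Longrightarrow> c (X ** Y) i = c X i * c Y i"
    "\<And>X i. X \<in> B \<Longrightarrow> i < length ks \<Longrightarrow> c (X\<^sup>\<dagger>) i = mat_adjoint (c X i)"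
proof -
  obtain \<phi> where bij: "bij_betw \<phi> B (matrix_direct_sum ks)"
    and hom: "\<forall>X\<in>B. \<forall>Y\<in>B. \<phi> (X + Y) = map2 (+) (\<phi> X) (\<phi> Y)"
      "\<forall>a. \<forall>X\<in>B. \<phi> (cmat_scale a X) = map (\<lambda>A. a \<cdot>\<^sub>m A) (\<phi> X)"
      "\<forall>X\<in>B. \<forall>Y\<in>B. \<phi> (X ** Y) = map2 (*) (\<phi> X) (\<phi> Y)"
      "\<forall>X\<in>B. \<phi> (X\<^sup>\<dagger>) = map mat_adjoint (\<phi> X)"
    using iso unfolding star_isomorphic_direct_sum_def by metis
  have mem: "\<phi> X \<in> matrix_direct_sum ks" if "X \<in> B" for X
    using bij that by (rule bij_betwE[THEN bspec])
  then have len: "length (\<phi> X) = length ks" if "X \<in> B" for X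
    using that by (auto simp: matrix_direct_sum_def dest: list_all2_lengthD)
  show thesis
  proof (rule that[of "\<lambda>X i. \<phi> X ! i"])
    show "\<phi> X ! i \<in> carrier_mat (ks ! i) (ks ! i)" if "X \<in> B" "i < length ks" for X i
      using mem[OF that(1)] that(2) len[OF that(1)] by (auto simp: matrix_direct_sum_def list_all2_conv_all_nth)
    show "X = Y" if "X \<in> B" "Y \<in> B" "\<forall>i<length ks. \<phi> X ! i = \<phi> Y ! i" for X Y
    proof -
      have "\<phi> X = \<phi> Y"
        using that len by (intro nth_equalityI) auto
      then show ?thesis
        using bij that by (auto simp: bij_betw_def dest: inj_onD)
    qed
    show "\<exists>X\<in>B. \<forall>i<length ks. \<phi> X ! i = M i"
      if "\<forall>i<length ks. M i \<in> carrier_mat (ks ! i) (ks ! i)" for M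
    proof -
      have "map M [0..<length ks] \<in> matrix_direct_sum ks"
        using that by (auto simp: matrix_direct_sum_def list_all2_conv_all_nth)
      then obtain X where "X \<in> B" "\<phi> X = map M [0..<length ks]"
        using bij by (metis bij_betw_imp_surj_on imageE)
      then show ?thesis
        by (intro bexI[of _ X]) auto
    qed
  qed (simp_all add: hom len)
qed

text \<open>\<open>z i\<close> corresponds to the identity of block i and \<open>f i\<close> to its
  matrix unit at (0, 0), so the trace of \<open>f i\<close> is the multiplicity of the block. The
  trace formula holds because the diagonal matrix units of a block are equivalent through
  off-diagonal ones, hence have equal traces, and add up to \<open>z i\<close>.\<close>

lemma star_isomorphism_blocks:
  fixes B :: "(complex^'n^'n) set"
  assumes iso: "star_isomorphic_direct_sum B ks" and B: "star_algebra B" "unit_cmat \<in> B"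
    and pos: "\<And>i. i < length ks \<Longrightarrow> 0 < ks ! i"
  obtains z f :: "nat \<Rightarrow> complex^'n^'n" where
    "\<forall>i<length ks. projection (z i) \<and> z i \<in> B \<and> z i \<in> commutant B"
    "\<forall>i<length ks. \<forall>j<length ks. i \<noteq> j \<longrightarrow> z i ** z j = 0"
    "(\<Sum>i<length ks. z i) = unit_cmat"
    "\<forall>i<length ks. projection (f i) \<and> f i \<in> B \<and> f i \<noteq> 0 \<and> z i ** f i = f i"
    "\<forall>i<length ks. \<forall>X\<in>B. \<exists>a. f i ** X ** f i = cmat_scale a (f i)"
    "\<forall>i<length ks. rtrace (z i) = real (ks ! i) * rtrace (f i)"
proof -
  obtain c :: "complex^'n^'n \<Rightarrow> nat \<Rightarrow> complex mat" where
    carr: "\<And>X i. X \<in> B \<Longrightarrow> i < length ks \<Longrightarrow> c X i \<in> carrier_mat (ks ! i) (ks ! i)"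
    and inj': "\<And>X Y. X \<in> B \<Longrightarrow> Y \<in> B \<Longrightarrow> \<forall>i<length ks. c X i = c Y i \<Longrightarrow> X = Y"
    and surj: "\<And>M. \<forall>i<length ks. M i \<in> carrier_mat (ks ! i) (ks ! i) \<Longrightarrow>
       \<exists>X\<in>B. \<forall>i<length ks. c X i = M i"
    and c_add: "\<And>X Y i. X \<in> B \<Longrightarrow> Y \<in> B \<Longrightarrow> i < length ks \<Longrightarrow> c (X + Y) i = c X i + c Y i"
    and c_scale: "\<And>a X i. X \<in> B \<Longrightarrow> i < length ks \<Longrightarrow> c (cmat_scale a X) i = a \<cdot>\<^sub>m c X i"
    and c_mult: "\<And>X Y i. X \<in> B \<Longrightarrow> Y \<in> B \<Longrightarrow> i < length ks \<Longrightarrow> c (X ** Y) i = c X i * c Y i"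
    and c_adj: "\<And>X i. X \<in> B \<Longrightarrow> i < length ks \<Longrightarrow> c (X\<^sup>\<dagger>) i = mat_adjoint (c X i)"
    by (rule star_isomorphism_components[OF iso B(1)], rule that, assumption+)
  have inj: "X = Y" if "X \<in> B" "Y \<in> B" "\<And>i. i < length ks \<Longrightarrow> c X i = c Y i" for X Y
    using inj' that by blast
  note BD = star_algebraD[OF B(1)]
  let ?d = "length ks"
  have c_zero: "c 0 i = 0\<^sub>m (ks ! i) (ks ! i)" if "i < ?d" for i
  proof -
    have "c (cmat_scale 0 0) i = 0 \<cdot>\<^sub>m c 0 i"
      using that BD(2) by (intro c_scale)
    moreover have "0 \<cdot>\<^sub>m c 0 i = 0\<^sub>m (ks ! i) (ks ! i)"
      using carr[OF BD(2) that] by (intro eq_matI) auto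
    ultimately show ?thesis
      by simp
  qed
  \<comment> \<open>\<open>Q i A\<close> singles out the element of \<open>B\<close> with component
    \<open>A\<close> in block i and 0 elsewhere; \<open>G i A\<close> below is this element.\<close>
  define Q where "Q i A X \<longleftrightarrow> X \<in> B \<and>
      (\<forall>j<?d. c X j = (if j = i then A else 0\<^sub>m (ks ! j) (ks ! j)))" for i A X
  define G where "G i A = (SOME X. Q i A X)" for i A
  have QG: "Q i A (G i A)" if "A \<in> carrier_mat (ks ! i) (ks ! i)" for i A
  proof -
    have "\<forall>j<?d. (if j = i then A else 0\<^sub>m (ks ! j) (ks ! j)) \<in> carrier_mat (ks ! j) (ks ! j)"
      using that by simp
    from surj[OF this] have "\<exists>X. Q i A X"
      unfolding Q_def by blast
    then show ?thesis
      unfolding G_def by (rule someI_ex)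
  qed
  have G: "\<And>i A. i < ?d \<Longrightarrow> A \<in> carrier_mat (ks ! i) (ks ! i) \<Longrightarrow> G i A \<in> B"
      "\<And>i A j. i < ?d \<Longrightarrow> A \<in> carrier_mat (ks ! i) (ks ! i) \<Longrightarrow> j < ?d \<Longrightarrow>
         c (G i A) j = (if j = i then A else 0\<^sub>m (ks ! j) (ks ! j))"
    using QG unfolding Q_def by blast+
  have G_mult: "G i A ** G i A' = G i (A * A')"
    if "i < ?d" "A \<in> carrier_mat (ks ! i) (ks ! i)" "A' \<in> carrier_mat (ks ! i) (ks ! i)" for i A A'
    using that by (intro inj) (auto simp: G c_mult BD intro!: eq_matI)
  have adj0: "mat_adjoint (0\<^sub>m k k :: complex mat) = 0\<^sub>m k k" for k
    using mat_adjoint_carrier[of "0\<^sub>m k k" k] by (intro eq_matI) (auto simp: index_mat_adjoint[of _ k])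
  have G_adj: "(G i A)\<^sup>\<dagger> = G i (mat_adjoint A)"
    if "i < ?d" "A \<in> carrier_mat (ks ! i) (ks ! i)" for i A
    using that by (intro inj) (auto simp: G c_adj BD mat_adjoint_carrier adj0)
  have G_zero: "G i A = 0 \<longleftrightarrow> A = 0\<^sub>m (ks ! i) (ks ! i)" if "i < ?d" "A \<in> carrier_mat (ks ! i) (ks ! i)" for i A
  proof
    assume "G i A = 0"
    then show "A = 0\<^sub>m (ks ! i) (ks ! i)"
      using G(2)[OF that that(1)] c_zero[OF that(1)] by simp
  next
    assume "A = 0\<^sub>m (ks ! i) (ks ! i)"
    then show "G i A = 0"
      using that by (intro inj) (auto simp: G c_zero BD)
  qed
  define z where "z i = G i (1\<^sub>m (ks ! i))" for i
  define U where "U i a b = G i (matrix_unit (ks ! i) a b)" for i a b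
  define f where "f i = U i 0 0" for i
  have zB: "z i \<in> B" if "i < ?d" for i
    using that by (simp add: z_def G)
  have UB: "U i a b \<in> B" if "i < ?d" for i a b
    using that by (simp add: U_def G)
  have c_z: "c (z i) j = (if j = i then 1\<^sub>m (ks ! j) else 0\<^sub>m (ks ! j) (ks ! j))" if "i < ?d" "j < ?d" for i j
    using that by (simp add: z_def G)
  have adj1: "mat_adjoint (1\<^sub>m k :: complex mat) = 1\<^sub>m k" for k
    using mat_adjoint_carrier[of "1\<^sub>m k" k] by (intro eq_matI) (auto simp: index_mat_adjoint[of _ k])
  have pz: "projection (z i)" if "i < ?d" for i
    using that by (simp add: projection_def z_def G_mult G_adj adj1)
  have cz: "z i \<in> commutant B" if "i < ?d" for i
    unfolding commutant_def
  proof clarify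
    fix X assume X: "X \<in> B"
    show "X ** z i = z i ** X"
    proof (rule inj)
      show "c (X ** z i) j = c (z i ** X) j" if "j < ?d" for j
        using that \<open>i < ?d\<close> X carr[OF X that] zB[OF \<open>i < ?d\<close>] by (auto simp: c_mult c_z)
    qed (use X zB that BD in auto)
  qed
  have zz: "z i ** z j = 0" if "i < ?d" "j < ?d" "i \<noteq> j" for i j
  proof (rule inj)
    show "c (z i ** z j) l = c 0 l" if "l < ?d" for l
      using that \<open>i < ?d\<close> \<open>j < ?d\<close> \<open>i \<noteq> j\<close> zB by (simp add: c_mult c_z c_zero)
  qed (use that zB BD in auto)
  have sumB: "(\<Sum>i\<in>I. g i) \<in> B" if "\<And>i. i \<in> I \<Longrightarrow> g i \<in> B" for g :: "nat \<Rightarrow> complex^'n^'n" and I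
    using that by (intro cmat.subspace_sum BD(1))
  have sum1: "(\<Sum>i<?d. z i) = unit_cmat"
  proof -
    \<comment> \<open>The components of \<open>unit_cmat\<close> are not known in advance. Instead
      the defect \<open>w\<close> is shown to vanish: multiplying by \<open>z j\<close> leaves its
      j-th component unchanged, yet gives 0.\<close>
    define w where "w = unit_cmat - (\<Sum>i<?d. z i)"
    have wB: "w \<in> B"
      unfolding w_def using zB by (intro BD(4) sumB B) auto
    have wz: "w ** z j = 0" if "j < ?d" for j
    proof -
      have "(\<Sum>i<?d. z i ** z j) = (\<Sum>i<?d. if i = j then z j else 0)"
        using that zz pz by (intro sum.cong) (auto simp: projectionD)
      then show ?thesis
        using that by (simp add: w_def cmat_distribs cmat_sum_mult)
    qed
    have "w = 0"
    proof (rule inj)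
      show "c w j = c 0 j" if j: "j < ?d" for j
        using c_mult[OF wB zB[OF j] j] carr[OF wB j] by (simp add: wz j c_z)
    qed (use wB BD in auto)
    then show ?thesis
      by (simp add: w_def)
  qed
  have UU: "U i a b ** U i b' e = (if b = b' then U i a e else 0)"
    if "i < ?d" "a < ks ! i" "b < ks ! i" "b' < ks ! i" "e < ks ! i" for i a b b' e
    using that G_zero[OF that(1)] by (simp add: U_def G_mult matrix_unit_mult)
  have Uadj: "(U i a b)\<^sup>\<dagger> = U i b a" if "i < ?d" for i a b
    using that by (simp add: U_def G_adj mat_adjoint_matrix_unit)
  have pU: "projection (U i a a)" if "i < ?d" "a < ks ! i" for i a
    using that by (simp add: projection_def UU Uadj)
  have zU: "z i ** U i a b = U i a b" "U i a b ** z i = U i a b" if "i < ?d" for i a b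
    using that by (simp_all add: z_def U_def G_mult left_mult_one_mat[OF matrix_unit_carrier] right_mult_one_mat[OF matrix_unit_carrier])
  have sumU: "(\<Sum>a<ks ! i. U i a a) = z i" if i: "i < ?d" for i
  proof -
    \<comment> \<open>Again the defect vanishes: multiplication by a diagonal matrix unit extracts a
      column of its i-th component, and every such product is 0.\<close>
    define w where "w = z i - (\<Sum>a<ks ! i. U i a a)"
    have wB: "w \<in> B"
      unfolding w_def using zB UB i by (intro BD(4) sumB) auto
    have wz: "w ** z i = w"
      using i zU pz[OF i] by (simp add: w_def cmat_distribs cmat_sum_mult projectionD)
    have wU: "w ** U i b b = 0" if "b < ks ! i" for b
    proof -
      have "(\<Sum>a<ks ! i. U i a a ** U i b b) = (\<Sum>a<ks ! i. if a = b then U i b b else 0)"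
        using that i UU by (intro sum.cong) auto
      then show ?thesis
        using that i by (simp add: w_def cmat_distribs cmat_sum_mult zU)
    qed
    have "w = 0"
    proof (rule inj)
      show "c w j = c 0 j" if j: "j < ?d" for j
      proof (cases "j = i")
        case False
        then show ?thesis
          using c_mult[OF wB zB[OF i] j] carr[OF wB j] by (simp add: wz j i c_z c_zero)
      next
        case True
        have "c w i = 0\<^sub>m (ks ! i) (ks ! i)"
        proof (rule eq_matI)
          fix x y assume "x < dim_row (0\<^sub>m (ks ! i) (ks ! i) :: complex mat)" "y < dim_col (0\<^sub>m (ks ! i) (ks ! i) :: complex mat)"
          then have xy: "x < ks ! i" "y < ks ! i"
            by auto
          have "c w i * matrix_unit (ks ! i) y y = 0\<^sub>m (ks ! i) (ks ! i)"
            using c_mult[OF wB UB[OF i] i, of y y] wU[OF xy(2)] i by (simp add: c_zero U_def G)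
          then have "(c w i * matrix_unit (ks ! i) y y) $$ (x, y) = 0"
            using xy by simp
          then show "c w i $$ (x, y) = 0\<^sub>m (ks ! i) (ks ! i) $$ (x, y)"
            using index_mult_matrix_unit[OF carr[OF wB i] xy(2) xy, of y] xy by simp
        qed (use carr[OF wB i] in auto)
        then show ?thesis
          using True i by (simp add: c_zero)
      qed
    qed (use wB BD in auto)
    then show ?thesis
      by (simp add: w_def)
  qed
  have f0: "f i \<noteq> 0" if i: "i < ?d" for i
  proof
    assume "f i = 0"
    then have "matrix_unit (ks ! i) 0 0 = 0\<^sub>m (ks ! i) (ks ! i)"
      using G_zero[OF i, of "matrix_unit (ks ! i) 0 0"] by (simp add: f_def U_def)
    then have "matrix_unit (ks ! i) 0 0 $$ (0, 0) = 0\<^sub>m (ks ! i) (ks ! i) $$ (0, 0)"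
      by simp
    then show False
      using pos[OF i] by simp
  qed
  have fXf: "\<exists>a. f i ** X ** f i = cmat_scale a (f i)" if i: "i < ?d" and X: "X \<in> B" for i X
  proof (intro exI, rule inj)
    let ?a = "c X i $$ (0, 0)"
    show "f i ** X ** f i \<in> B" "cmat_scale ?a (f i) \<in> B"
      using UB[OF i] X by (auto simp: f_def intro!: BD)
    show "c (f i ** X ** f i) j = c (cmat_scale ?a (f i)) j" if j: "j < ?d" for j
    proof (cases "j = i")
      case False
      then show ?thesis
        using i j X UB[OF i] carr[OF X j] by (simp add: f_def c_mult c_scale BD U_def G)
    next
      case True
      define k where "k = ks ! i"
      have A: "c X i \<in> carrier_mat k k"
        using carr[OF X i] by (simp add: k_def)
      have k0: "0 < k"
        using pos[OF i] by (simp add: k_def)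
      have "matrix_unit k 0 0 * c X i * matrix_unit k 0 0 = ?a \<cdot>\<^sub>m matrix_unit k 0 0"
      proof (rule eq_matI)
        fix x y assume "x < dim_row (?a \<cdot>\<^sub>m matrix_unit k 0 0)" "y < dim_col (?a \<cdot>\<^sub>m matrix_unit k 0 0)"
        then have xy: "x < k" "y < k"
          by (auto simp: matrix_unit_def)
        have m: "matrix_unit k 0 0 * c X i \<in> carrier_mat k k"
          using A by (intro mult_carrier_mat) auto
        show "(matrix_unit k 0 0 * c X i * matrix_unit k 0 0) $$ (x, y) = (?a \<cdot>\<^sub>m matrix_unit k 0 0) $$ (x, y)"
          using index_mult_matrix_unit[OF m k0 xy, of 0] index_matrix_unit_mult[OF A k0 xy(1) k0, of 0] xy
          by (auto simp: matrix_unit_def)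
      qed (use A in \<open>auto simp: matrix_unit_def\<close>)
      then show ?thesis
        using True i X UB[OF i] by (simp add: f_def c_mult c_scale BD U_def G k_def)
    qed
  qed
  have trz: "rtrace (z i) = real (ks ! i) * rtrace (f i)" if i: "i < ?d" for i
  proof -
    have "rtrace (U i a a) = rtrace (f i)" if a: "a < ks ! i" for a
    proof -
      have "rtrace (U i a 0 ** U i 0 a) = rtrace (U i 0 a ** U i a 0)"
        by (rule rtrace_commute)
      then show ?thesis
        using i a pos[OF i] by (simp add: UU f_def)
    qed
    then have "rtrace (\<Sum>a<ks ! i. U i a a) = (\<Sum>a<ks ! i. rtrace (f i))"
      by (simp add: rtrace_sum)
    then show ?thesis
      by (simp add: sumU[OF i])
  qed
  show thesis
    by (rule that[of z f]) (use pz zB cz zz sum1 pU UB zU pos f0 fXf trz in \<open>auto simp: f_def\<close>)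
qed

section \<open>Perturbation of the intersection\<close>

lemma orthonormal_sequence:
  fixes S :: "'a::euclidean_space set"
  assumes "Real_Vector_Spaces.subspace S" "k \<le> dim S"
  obtains g :: "nat \<Rightarrow> 'a" where "\<And>i. i < k \<Longrightarrow> g i \<in> S"
    "\<And>i j. i < k \<Longrightarrow> j < k \<Longrightarrow> g i \<bullet> g j = (if i = j then 1 else 0)"
proof -
  obtain C where C: "C \<subseteq> S" "pairwise real_inner_class.orthogonal C" "\<And>x. x \<in> C \<Longrightarrow> norm x = 1"
      "independent C" "card C = dim S" "span C = S"
    using orthonormal_basis_subspace[OF assms(1)] by blast
  have "finite C"
    using C(4) by (rule independent_imp_finite)
  then obtain g where g: "bij_betw g {0..<card C} C"
    using ex_bij_betw_nat_finite by blast
  show thesis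
  proof (rule that[of g])
    show "g i \<in> S" if "i < k" for i
      using g that assms(2) C by (auto simp: bij_betw_def)
    show "g i \<bullet> g j = (if i = j then 1 else 0)" if "i < k" "j < k" for i j
    proof -
      have ij: "i \<in> {0..<card C}" "j \<in> {0..<card C}"
        using that assms(2) C(5) by auto
      then have mem: "g i \<in> C" "g j \<in> C"
        using g by (auto simp: bij_betw_def)
      show ?thesis
      proof (cases "i = j")
        case True
        then show ?thesis
          using C(3)[OF mem(1)] by (simp add: dot_square_norm)
      next
        case False
        then have "g i \<noteq> g j"
          using g ij by (auto simp: bij_betw_def dest: inj_onD)
        then show ?thesis
          using C(2) mem False by (auto simp: pairwise_def real_inner_class.orthogonal_def)
      qed
    qed
  qed
qed

text \<open>Bolzano-Weierstrass applied once for each of the \<open>k\<close> sequences, refining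
  the subsequence each time.\<close>

lemma common_convergent_subsequence:
  fixes g :: "nat \<Rightarrow> nat \<Rightarrow> 'a::euclidean_space"
  assumes "\<And>n i. i < k \<Longrightarrow> norm (g n i) \<le> 1"
  obtains r l where "strict_mono (r :: nat \<Rightarrow> nat)" "\<And>i. i < k \<Longrightarrow> (\<lambda>n. g (r n) i) \<longlonglongrightarrow> l i"
proof -
  have "\<exists>r. strict_mono (r :: nat \<Rightarrow> nat) \<and> (\<forall>i<m. convergent (\<lambda>n. g (r n) i))" if "m \<le> k" for m
    using that
  proof (induction m)
    case 0
    then show ?case
      by (intro exI[of _ id]) (auto simp: strict_mono_def)
  next
    case (Suc m)
    then obtain r :: "nat \<Rightarrow> nat" where r: "strict_mono r" "\<forall>i<m. convergent (\<lambda>n. g (r n) i)"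
      by auto
    have "\<forall>n. g (r n) m \<in> cball 0 1"
      using assms[of m] Suc.prems by simp
    then obtain l s where s: "strict_mono (s :: nat \<Rightarrow> nat)" "((\<lambda>n. g (r n) m) \<circ> s) \<longlonglongrightarrow> l"
      using compact_cball[of 0 1, unfolded compact_def, rule_format, of "\<lambda>n. g (r n) m"] by auto
    have "convergent (\<lambda>n. g (r (s n)) i)" if "i < Suc m" for i
    proof (cases "i = m")
      case True
      then show ?thesis
        using s(2) by (auto simp: o_def convergent_def)
    next
      case False
      then have "convergent (\<lambda>n. g (r n) i)"
        using r that by simp
      then show ?thesis
        using convergent_subseq_convergent[OF _ s(1)] by (fastforce simp: o_def)
    qed
    then show ?case
      using strict_mono_o[OF r(1) s(1)] by (intro exI[of _ "r \<circ> s"]) (simp add: o_def)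
  qed
  then obtain r :: "nat \<Rightarrow> nat" where r: "strict_mono r" "\<forall>i<k. convergent (\<lambda>n. g (r n) i)"
    by blast
  then have "\<And>i. i < k \<Longrightarrow> (\<lambda>n. g (r n) i) \<longlonglongrightarrow> lim (\<lambda>n. g (r n) i)"
    by (simp add: convergent_LIMSEQ_iff)
  then show thesis
    by (rule that[OF r(1)])
qed

text \<open>
  Limits of orthonormal systems in \<open>S n\<close> are orthonormal in \<open>T\<close>; as \<open>dim T \<le> dim (S n)\<close> they
  already span \<open>T\<close>.
\<close>
lemma subspace_limit:
  fixes S :: "nat \<Rightarrow> 'a::euclidean_space set"
  assumes S: "\<And>n. Real_Vector_Spaces.subspace (S n)" "\<And>n. dim T \<le> dim (S n)"
    and cl: "\<And>r x l. strict_mono r \<Longrightarrow> \<forall>n. x n \<in> S (r n) \<Longrightarrow> x \<longlonglongrightarrow> l \<Longrightarrow> l \<in> T"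
    and d: "d \<in> T"
  obtains r x where "strict_mono (r :: nat \<Rightarrow> nat)" "\<And>n. x n \<in> S (r n)" "x \<longlonglongrightarrow> d"
proof -
  let ?k = "dim T"
  have "\<exists>g. (\<forall>i<?k. g i \<in> S n) \<and> (\<forall>i<?k. \<forall>j<?k. g i \<bullet> g j = (if i = j then 1 else 0))" for n
    using orthonormal_sequence[OF S] by metis
  then obtain g where g: "\<And>n i. i < ?k \<Longrightarrow> g n i \<in> S n"
      "\<And>n i j. i < ?k \<Longrightarrow> j < ?k \<Longrightarrow> g n i \<bullet> g n j = (if i = j then 1 else 0)"
    by metis
  have "norm (g n i) \<le> 1" if "i < ?k" for n i
    using g(2)[OF that that, of n] by (simp add: norm_eq_sqrt_inner)
  then obtain r l where r: "strict_mono (r :: nat \<Rightarrow> nat)" "\<And>i. i < ?k \<Longrightarrow> (\<lambda>n. g (r n) i) \<longlonglongrightarrow> l i"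
    using common_convergent_subsequence[of ?k g] by blast
  have lT: "l i \<in> T" if "i < ?k" for i
    using cl[OF r(1) _ r(2)[OF that]] g(1)[OF that] by blast
  have ll: "l i \<bullet> l j = (if i = j then 1 else 0)" if "i < ?k" "j < ?k" for i j
  proof -
    have "(\<lambda>n. g (r n) i \<bullet> g (r n) j) \<longlonglongrightarrow> l i \<bullet> l j"
      using that by (intro tendsto_inner r)
    moreover have "(\<lambda>n. g (r n) i \<bullet> g (r n) j) \<longlonglongrightarrow> (if i = j then 1 else 0)"
      using that by (simp add: g)
    ultimately show ?thesis
      by (rule LIMSEQ_unique)
  qed
  have inj: "inj_on l {..<?k}"
  proof (rule inj_onI)
    fix i j assume "i \<in> {..<?k}" "j \<in> {..<?k}" "l i = l j"
    then show "i = j"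
      using ll[of i j] ll[of j j] by (auto split: if_splits)
  qed
  have orth: "pairwise real_inner_class.orthogonal (l ` {..<?k})"
    using ll by (auto simp: pairwise_def real_inner_class.orthogonal_def)
  have nrm: "norm x = 1" if "x \<in> l ` {..<?k}" for x
    using that ll by (auto simp: norm_eq_sqrt_inner)
  have "0 \<notin> l ` {..<?k}"
    using nrm[of 0] by auto
  with orth have "independent (l ` {..<?k})"
    by (rule pairwise_orthogonal_independent)
  then have "T \<subseteq> span (l ` {..<?k})"
    using lT inj by (intro card_ge_dim_independent) (auto simp: card_image)
  then have "(\<Sum>x\<in>l ` {..<?k}. (d \<bullet> x) *\<^sub>R x) = d"
    using orth nrm d by (intro orthonormal_basis_expand) auto
  then have d_eq: "(\<Sum>i<?k. (d \<bullet> l i) *\<^sub>R l i) = d"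
    by (simp add: sum.reindex[OF inj])
  \<comment> \<open>The coefficients of \<open>d\<close> in the limit system are kept and the
    approximating systems are put in place of the limit.\<close>
  define x where "x n = (\<Sum>i<?k. (d \<bullet> l i) *\<^sub>R g (r n) i)" for n
  have "x \<longlonglongrightarrow> (\<Sum>i<?k. (d \<bullet> l i) *\<^sub>R l i)"
    unfolding x_def[abs_def] by (intro tendsto_sum tendsto_scaleR tendsto_const r) auto
  then have "x \<longlonglongrightarrow> d"
    by (simp add: d_eq)
  moreover have "x n \<in> S (r n)" for n
    unfolding x_def by (intro subspace_sum S subspace_scale g) auto
  ultimately show thesis
    using that r(1) by blast
qed

section \<open>Differentiation along unitaries\<close>

lemma bounded_bilinear_cmat_mult: "bounded_bilinear ((**) :: complex^'n^'n \<Rightarrow> complex^'n^'n \<Rightarrow> complex^'n^'n)"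
  unfolding bilinear_conv_bounded_bilinear[symmetric]
  by (auto simp: bilinear_def intro!: linearI simp: cmat_distribs scaleR_eq_scale)

lemma tendsto_cmat_mult:
  fixes f g :: "'b \<Rightarrow> complex^'n^'n"
  shows "(f \<longlongrightarrow> a) F \<Longrightarrow> (g \<longlongrightarrow> b) F \<Longrightarrow> ((\<lambda>x. f x ** g x) \<longlongrightarrow> a ** b) F"
  by (rule bounded_bilinear.tendsto[OF bounded_bilinear_cmat_mult])

lemma tendsto_cmat_scale:
  fixes g :: "'b \<Rightarrow> complex^'n^'n"
  assumes "(c \<longlongrightarrow> a) F" "(g \<longlongrightarrow> b) F"
  shows "((\<lambda>x. cmat_scale (c x) (g x)) \<longlongrightarrow> cmat_scale a b) F"
  by (intro vec_tendstoI) (use assms in \<open>auto intro!: tendsto_mult tendsto_vec_nth\<close>)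

lemma tendsto_adjoint:
  fixes f :: "'b \<Rightarrow> complex^'n^'n"
  assumes "(f \<longlongrightarrow> a) F"
  shows "((\<lambda>x. (f x)\<^sup>\<dagger>) \<longlongrightarrow> a\<^sup>\<dagger>) F"
  by (intro vec_tendstoI) (use assms in \<open>auto intro!: tendsto_cnj tendsto_vec_nth\<close>)

lemma mem_subspace_if_orthogonal:
  fixes V :: "'a::euclidean_space set"
  assumes V: "Real_Vector_Spaces.subspace V" and x: "\<And>y. (\<And>v. v \<in> V \<Longrightarrow> v \<bullet> y = 0) \<Longrightarrow> x \<bullet> y = 0"
  shows "x \<in> V"
proof -
  obtain a b where ab: "a \<in> span V" "\<And>w. w \<in> span V \<Longrightarrow> real_inner_class.orthogonal b w" "x = a + b"
    using orthogonal_subspace_decomp_exists[of V x] by blast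
  have a: "a \<in> V"
    using ab(1) V by (simp add: span_eq_iff[THEN iffD2])
  have vb: "v \<bullet> b = 0" if "v \<in> V" for v
    using ab(2)[OF span_base[OF that]] by (simp add: real_inner_class.orthogonal_def inner_commute)
  have "x \<bullet> b = 0"
    using vb by (rule x)
  then have "b = 0"
    using vb[OF a] by (simp add: ab(3) inner_add_left)
  then show ?thesis
    using a ab(3) by simp
qed

lemma cis_difference_quotient:
  "(\<lambda>n. (cis (inverse (real (Suc n))) - 1) / complex_of_real (inverse (real (Suc n)))) \<longlonglongrightarrow> \<i>"
proof -
  have d: "((\<lambda>z. exp (\<i> * z)) has_field_derivative \<i>) (at 0)"
    by (auto intro!: derivative_eq_intros)
  have "(\<lambda>n. complex_of_real (inverse (real (Suc n)))) \<longlonglongrightarrow> complex_of_real 0"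
    by (rule tendsto_of_real[OF LIMSEQ_inverse_real_of_nat])
  then have lim: "filterlim (\<lambda>n. complex_of_real (inverse (real (Suc n)))) (at 0) sequentially"
    by (intro filterlim_atI) (auto intro!: always_eventually simp del: of_nat_Suc)
  have "((\<lambda>z. (exp (\<i> * z) - 1) / z) \<longlongrightarrow> \<i>) (at 0)"
    using d by (simp add: has_field_derivative_iff)
  from filterlim_compose[OF this lim] show ?thesis
    by (simp add: cis_conv_exp mult.commute)
qed

text \<open>Expanding |1 + c|^2 = 1 gives c + cnj c + c cnj c = 0, which is exactly what cancels in
  the product with the adjoint. For c = \<open>cis t - 1\<close> the matrix is the exponential of i
  t q.\<close>

lemma unitary_add_projection:
  assumes q: "projection q" and c: "cmod (1 + c) = 1"
  shows "unit_cmat + cmat_scale c q \<in> unitary_group"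
proof -
  have "(1 + c) * cnj (1 + c) = complex_of_real ((cmod (1 + c))\<^sup>2)"
    by (rule complex_norm_square[symmetric])
  then have "c + cnj c + c * cnj c = 0"
    by (simp add: c algebra_simps)
  then have z: "cmat_scale (c + cnj c + c * cnj c) q = 0"
    by simp
  then have "cmat_scale c q + cmat_scale (cnj c) q + cmat_scale (c * cnj c) q = 0"
    by (simp add: cmat.scale_left_distrib)
  then show ?thesis
    by (simp add: unitary_group_def cmat_distribs projectionD[OF q] algebra_simps)
qed

lemma unitary_mult: "u \<in> unitary_group \<Longrightarrow> v \<in> unitary_group \<Longrightarrow> u ** v \<in> unitary_group"
  unfolding unitary_group_def by simp (metis matrix_mul_assoc cmat_mult_unit(1))

lemma closed_cmat_subspace: "cmat.subspace A \<Longrightarrow> closed A"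
  by (intro closed_subspace cmat_subspace_imp_subspace)

text \<open>
  If \<open>d\<close> can be followed inside \<open>A \<inter> w C w\<^sup>*\<close> along the unitaries \<open>w = 1 + (e\<^sup>i\<^sup>t - 1) q\<close> for
  \<open>t \<rightarrow> 0\<close>, then differentiating at \<open>t = 0\<close> puts \<open>[d, q]\<close> into \<open>A + C\<close>. No derivative of the
  path in \<open>d\<close> is needed after pairing with a vector orthogonal to \<open>A\<close> and to \<open>C\<close>.
\<close>
lemma commutator_in_sum:
  fixes A C :: "(complex^'n^'n) set"
  assumes A: "cmat.subspace A" and C: "cmat.subspace C" and q: "projection q"
    and t: "t \<longlonglongrightarrow> 0" "(\<lambda>n. (cis (t n) - 1) / complex_of_real (t n)) \<longlonglongrightarrow> \<i>"
    and w: "\<And>n. w n = unit_cmat + cmat_scale (cis (t n) - 1) q"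
    and x: "\<And>n. x n \<in> A" "\<And>n. (w n)\<^sup>\<dagger> ** x n ** w n \<in> C" "x \<longlonglongrightarrow> d"
  shows "\<exists>a\<in>A. \<exists>c\<in>C. d ** q - q ** d = a + c"
proof -
  define V where "V = {a + c | a c. a \<in> A \<and> c \<in> C}"
  define c where "c n = cis (t n) - 1" for n
  define k where "k n = c n / complex_of_real (t n)" for n
  \<comment> \<open>The derivative at t = 0 of w* d w, that is, i times the commutator of
    \<open>d\<close> and \<open>q\<close>.\<close>
  define Z where "Z = cmat_scale (- \<i>) (q ** d) + cmat_scale \<i> (d ** q)"
  have subV: "cmat.subspace V"
    unfolding V_def using A C by (rule cmat.subspace_sums)
  have AV: "a \<in> V" if "a \<in> A" for a
    using that cmat.subspace_0[OF C] unfolding V_def by force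
  have CV: "b \<in> V" if "b \<in> C" for b
    using that cmat.subspace_0[OF A] unfolding V_def by force
  have "Z \<bullet> y = 0" if y: "\<And>v. v \<in> V \<Longrightarrow> v \<bullet> y = 0" for y
  proof -
    \<comment> \<open>The quotient (w* x w - x) / t with the moving element x. It lies in
      \<open>V\<close> for every n, since x is in \<open>A\<close> and w* x w is in
      \<open>C\<close>, and this form shows its limit without dividing by t any longer.\<close>
    define F where "F n = cmat_scale (cnj (k n)) (q ** x n) + cmat_scale (k n) (x n ** q)
        + cmat_scale (k n * cnj (c n)) (q ** x n ** q)" for n
    have k: "k \<longlonglongrightarrow> \<i>"
      using t(2) by (simp add: k_def[abs_def] c_def)
    have "c \<longlonglongrightarrow> cis 0 - 1"
      unfolding c_def[abs_def] cis_conv_exp by (intro tendsto_intros t(1))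
    then have c0: "c \<longlonglongrightarrow> 0"
      by simp
    have "F \<longlonglongrightarrow> cmat_scale (cnj \<i>) (q ** d) + cmat_scale \<i> (d ** q) + cmat_scale (\<i> * cnj 0) (q ** d ** q)"
      unfolding F_def[abs_def]
      by (intro tendsto_add tendsto_cmat_scale tendsto_cmat_mult tendsto_mult tendsto_cnj tendsto_const k c0 x(3))
    then have "F \<longlonglongrightarrow> Z"
      by (simp add: Z_def)
    then have lim: "(\<lambda>n. F n \<bullet> y) \<longlonglongrightarrow> Z \<bullet> y"
      by (intro tendsto_inner tendsto_const)
    have "F n \<bullet> y = 0" for n
    proof -
      have wxw: "(w n)\<^sup>\<dagger> ** x n ** w n - x n =
          cmat_scale (cnj (c n)) (q ** x n) + cmat_scale (c n) (x n ** q) + cmat_scale (c n * cnj (c n)) (q ** x n ** q)"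
        by (simp add: w c_def[symmetric] cmat_distribs projectionD[OF q] mult.commute cmat.scale_right_distrib)
      have "F n = cmat_scale (1 / complex_of_real (t n)) ((w n)\<^sup>\<dagger> ** x n ** w n - x n)"
        unfolding wxw F_def k_def by (simp add: cmat.scale_right_distrib)
      moreover have "(w n)\<^sup>\<dagger> ** x n ** w n - x n \<in> V"
        by (intro cmat.subspace_diff[OF subV] AV CV x)
      ultimately have "F n \<in> V"
        using cmat.subspace_scale[OF subV] by simp
      then show ?thesis
        by (rule y)
    qed
    then have "(\<lambda>n. F n \<bullet> y) \<longlonglongrightarrow> 0"
      by simp
    with lim show ?thesis
      by (rule LIMSEQ_unique)
  qed
  then have "Z \<in> V"
    by (rule mem_subspace_if_orthogonal[OF cmat_subspace_imp_subspace[OF subV]])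
  then have "cmat_scale (- \<i>) Z \<in> V"
    by (rule cmat.subspace_scale[OF subV])
  also have "cmat_scale (- \<i>) Z = d ** q - q ** d"
    by (rule cmat_eqI) (simp add: Z_def algebra_simps)
  finally show ?thesis
    by (auto simp: V_def)
qed

lemma outer_scaleR: "outer (r *\<^sub>R x) (r *\<^sub>R y) = (r * r) *\<^sub>R outer x y"
  by (rule cmat_eqI) simp

text \<open>Compressing the commutator with a rank one projection q leaves p q (1 - p). Suitable q
  produce, up to scaling, every rank one matrix of p M (1 - p), and these span.\<close>

lemma corner_dim_le:
  fixes A C :: "(complex^'n^'n) set"
  assumes A: "cmat.subspace A" and C: "cmat.subspace C" and p: "projection p"
    and comm: "\<And>q. projection q \<Longrightarrow> \<exists>a\<in>A. \<exists>c\<in>C. p ** q - q ** p = a + c"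
  shows "2 * rtrace p * (real CARD('n) - rtrace p)
    \<le> real (dim ((\<lambda>X. p ** X ** (unit_cmat - p)) ` A)) + real (dim ((\<lambda>X. p ** X ** (unit_cmat - p)) ` C))"
proof -
  define L where "L X = p ** X ** (unit_cmat - p)" for X
  have lin: "linear L"
    unfolding L_def by (rule linear_corner)
  define S where "S = {a + c | a c. a \<in> L ` A \<and> c \<in> L ` C}"
  have subs: "Real_Vector_Spaces.subspace (L ` A)" "Real_Vector_Spaces.subspace (L ` C)"
    using A C by (simp_all add: linear_subspace_image[OF lin] cmat_subspace_imp_subspace)
  then have subS: "Real_Vector_Spaces.subspace S"
    unfolding S_def by (rule subspace_sums)
  have L_outer: "L (outer a b) = outer (p *v a) ((unit_cmat - p) *v b)" for a b
    using projectionD(1)[OF projection_compl[OF p]] by (simp add: L_def mult_outer outer_mult del: adjoint_diff)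
  have out: "outer (p *v x) ((unit_cmat - p) *v y) \<in> S" for x y
  proof -
    \<comment> \<open>The two summands are orthogonal, so compressing \<open>outer v v\<close> by
      \<open>p\<close> and \<open>unit_cmat - p\<close> separates them again and recovers the given
      rank one matrix.\<close>
    define v where "v = p *v x + (unit_cmat - p) *v y"
    have pv: "p *v v = p *v x"
      using p by (simp add: v_def matrix_vector_right_distrib matrix_vector_mul_assoc cmat_distribs projectionD)
    have qv: "(unit_cmat - p) *v v = (unit_cmat - p) *v y"
      using p by (simp add: v_def matrix_vector_right_distrib matrix_vector_mul_assoc cmat_distribs projectionD)
    show ?thesis
    proof (cases "v = 0")
      case True
      then have "outer (p *v x) ((unit_cmat - p) *v y) = 0"
        using pv by (intro cmat_eqI) simp
      then show ?thesis
        using subspace_0[OF subS] by simp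
    next
      case False
      define e where "e = (1 / norm v) *\<^sub>R v"
      have e: "norm e = 1"
        using False by (simp add: e_def)
      obtain a c where ac: "a \<in> A" "c \<in> C" "p ** outer e e - outer e e ** p = a + c"
        using comm[OF projection_outer[OF e]] by blast
      have ve: "v = norm v *\<^sub>R e"
        using False by (simp add: e_def)
      \<comment> \<open>The other half of the commutator ends in \<open>p\<close>, which
        \<open>unit_cmat - p\<close> annihilates.\<close>
      have "L (outer e e) = L (p ** outer e e - outer e e ** p)"
        using p by (simp add: L_def cmat_distribs matrix_mul_assoc projectionD)
          (simp add: matrix_mul_assoc[symmetric] projectionD)
      also have "\<dots> = L a + L c"
        by (simp add: ac(3) linear_add[OF lin])
      finally have "L (outer e e) \<in> S"
        using ac by (auto simp: S_def)
      then have "(norm v * norm v) *\<^sub>R L (outer e e) \<in> S"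
        by (rule subspace_scale[OF subS])
      also have "(norm v * norm v) *\<^sub>R L (outer e e) = L (outer v v)"
        by (simp only: linear_scale[OF lin, symmetric] outer_scaleR[symmetric] ve[symmetric])
      also have "L (outer v v) = outer (p *v x) ((unit_cmat - p) *v y)"
        by (simp only: L_outer pv qv)
      finally show ?thesis .
    qed
  qed
  have "L X \<in> S" for X
  proof -
    have "L X = (\<Sum>i\<in>UNIV. \<Sum>j\<in>UNIV. outer (p *v (X $ i $ j *s axis i 1)) ((unit_cmat - p) *v axis j 1))"
    proof -
      have "L X = L (\<Sum>i\<in>UNIV. \<Sum>j\<in>UNIV. outer (X $ i $ j *s axis i 1) (axis j 1))"
      proof -
        have "cmat_scale c (outer a b) = outer (c *s a) b" for c :: complex and a b :: "complex^'n"
          by (rule cmat_eqI) simp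
        then show ?thesis
          using cmat_eq_sum_outer[of X] by simp
      qed
      also have "\<dots> = (\<Sum>i\<in>UNIV. \<Sum>j\<in>UNIV. L (outer (X $ i $ j *s axis i 1) (axis j 1)))"
        by (simp add: linear_sum[OF lin])
      also have "\<dots> = (\<Sum>i\<in>UNIV. \<Sum>j\<in>UNIV. outer (p *v (X $ i $ j *s axis i 1)) ((unit_cmat - p) *v axis j 1))"
        by (simp only: L_outer)
      finally show ?thesis .
    qed
    then show ?thesis
      using out by (simp add: subspace_sum[OF subS])
  qed
  then have "dim (range L) \<le> dim S"
    by (intro dim_subset) auto
  also have "\<dots> \<le> dim (L ` A) + dim (L ` C)"
    using dim_sums_Int[OF subs] by (simp add: S_def)
  finally have "real (dim (range L)) \<le> real (dim (L ` A)) + real (dim (L ` C))"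
    by linarith
  then show ?thesis
    using dim_corner[OF p projection_compl[OF p]] by (simp add: L_def[abs_def] rtrace_compl)
qed

section \<open>Unitary conjugates and the density criterion\<close>

lemma unital_cstar_subalgebraD:
  assumes "unital_cstar_subalgebra B"
  shows "star_algebra B" "unit_cmat \<in> B"
  using assms by (auto simp: unital_cstar_subalgebra_def star_algebra_def)

lemma unitary_conjugate_eq_iff:
  assumes "u \<in> unitary_group"
  shows "X = u ** Y ** u\<^sup>\<dagger> \<longleftrightarrow> u\<^sup>\<dagger> ** X ** u = Y"
proof -
  have u: "u ** u\<^sup>\<dagger> = unit_cmat" "u\<^sup>\<dagger> ** u = unit_cmat"
    using assms by (auto simp: unitary_group_def)
  have "u ** (u\<^sup>\<dagger> ** X ** u) ** u\<^sup>\<dagger> = (u ** u\<^sup>\<dagger>) ** X ** (u ** u\<^sup>\<dagger>)"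
    and "u\<^sup>\<dagger> ** (u ** Y ** u\<^sup>\<dagger>) ** u = (u\<^sup>\<dagger> ** u) ** Y ** (u\<^sup>\<dagger> ** u)"
    by (simp_all only: matrix_mul_assoc)
  then show ?thesis
    by (auto simp: u)
qed

text \<open>Pulling back to \<open>B\<close> replaces an image that varies with \<open>u\<close> by
  a condition on a fixed closed set, which passes to limits.\<close>

lemma mem_unitary_conjugate_iff:
  assumes "u \<in> unitary_group"
  shows "X \<in> (\<lambda>X. u ** X ** u\<^sup>\<dagger>) ` B \<longleftrightarrow> u\<^sup>\<dagger> ** X ** u \<in> B"
  using unitary_conjugate_eq_iff[OF assms] by (auto simp: image_iff)

lemma star_algebra_unitary_conjugate:
  assumes u: "u \<in> unitary_group" and B: "star_algebra B"
  shows "star_algebra ((\<lambda>X. u ** X ** u\<^sup>\<dagger>) ` B)"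
proof (rule star_algebraI)
  have uu: "u ** u\<^sup>\<dagger> = unit_cmat"
    using u by (auto simp: unitary_group_def)
  have mult: "u\<^sup>\<dagger> ** (X ** Y) ** u = (u\<^sup>\<dagger> ** X ** u) ** (u\<^sup>\<dagger> ** Y ** u)" for X Y
  proof -
    have "(u\<^sup>\<dagger> ** X ** u) ** (u\<^sup>\<dagger> ** Y ** u) = u\<^sup>\<dagger> ** X ** (u ** u\<^sup>\<dagger>) ** Y ** u"
      by (simp only: matrix_mul_assoc)
    then show ?thesis
      by (simp add: uu matrix_mul_assoc)
  qed
  show "X ** Y \<in> (\<lambda>X. u ** X ** u\<^sup>\<dagger>) ` B"
    if "X \<in> (\<lambda>X. u ** X ** u\<^sup>\<dagger>) ` B" "Y \<in> (\<lambda>X. u ** X ** u\<^sup>\<dagger>) ` B" for X Y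
    using that unfolding mem_unitary_conjugate_iff[OF u] mult by (rule star_algebraD(6)[OF B])
  show "X\<^sup>\<dagger> \<in> (\<lambda>X. u ** X ** u\<^sup>\<dagger>) ` B" if "X \<in> (\<lambda>X. u ** X ** u\<^sup>\<dagger>) ` B" for X
  proof -
    have "(u\<^sup>\<dagger> ** X ** u)\<^sup>\<dagger> \<in> B"
      using that unfolding mem_unitary_conjugate_iff[OF u] by (rule star_algebraD(7)[OF B])
    then show ?thesis
      unfolding mem_unitary_conjugate_iff[OF u] by (simp add: matrix_mul_assoc)
  qed
qed (use B in \<open>auto simp: mem_unitary_conjugate_iff[OF u] cmat_distribs star_algebraD\<close>)

text \<open>The perturbation argument common to all four cases. What it leaves open is a numerical
  bound for projections \<open>p\<close> and \<open>p'\<close> of equal rank in the two algebras;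
  \<open>p'\<close> will be the conjugate of \<open>p\<close> by the minimising unitary.\<close>

lemma dense_Delta_criterion:
  fixes B1 B2 :: "(complex^'n^'n) set"
  assumes B1: "unital_cstar_subalgebra B1" and B2: "unital_cstar_subalgebra B2"
    and bound: "\<And>p p'. projection p \<Longrightarrow> p \<in> B1 \<Longrightarrow> projection p' \<Longrightarrow> p' \<in> B2 \<Longrightarrow> rtrace p' = rtrace p \<Longrightarrow>
      p \<noteq> 0 \<Longrightarrow> p \<noteq> unit_cmat \<Longrightarrow> p' \<noteq> 0 \<Longrightarrow> p' \<noteq> unit_cmat \<Longrightarrow>
      real (dim ((\<lambda>X. p ** X ** (unit_cmat - p)) ` B1)) + real (dim ((\<lambda>X. p' ** X ** (unit_cmat - p')) ` B2))
        < 2 * rtrace p * (real CARD('n) - rtrace p)"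
  shows "(top_of_set unitary_group) closure_of (Delta B1 B2) = unitary_group"
proof -
  note A1 = unital_cstar_subalgebraD[OF B1] and A2 = unital_cstar_subalgebraD[OF B2]
  define conj where "conj u = (\<lambda>X. u ** X ** u\<^sup>\<dagger>) ` B2" for u
  define D where "D u = B1 \<inter> conj u" for u
  have conjA: "star_algebra (conj u)" if "u \<in> unitary_group" for u
    unfolding conj_def by (rule star_algebra_unitary_conjugate[OF that A2(1)])
  have unit_conj: "unit_cmat \<in> conj u" if "u \<in> unitary_group" for u
    using that A2(2) unfolding conj_def mem_unitary_conjugate_iff[OF that]
    by (simp add: unitary_group_def)
  have DA: "star_algebra (D u)" if "u \<in> unitary_group" for u
    using A1(1) conjA[OF that] unfolding D_def by (intro star_algebraI) (auto simp: star_algebraD)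
  have near: "\<exists>u\<in>Delta B1 B2. dist u0 u < \<epsilon>" if u0: "u0 \<in> unitary_group" and \<epsilon>: "\<epsilon> > 0" for u0 and \<epsilon> :: real
  proof -
    define K where "K u \<longleftrightarrow> u \<in> unitary_group \<and> dist u0 u < \<epsilon>" for u
    have "K u0"
      using u0 \<epsilon> by (simp add: K_def)
    then obtain u where Ku: "K u" and min: "\<And>v. K v \<Longrightarrow> dim (D u) \<le> dim (D v)"
      using ex_has_least_nat[of K u0 "\<lambda>v. dim (D v)"] by blast
    have u: "u \<in> unitary_group" "dist u0 u < \<epsilon>"
      using Ku by (auto simp: K_def)
    have uu: "u ** u\<^sup>\<dagger> = unit_cmat" "u\<^sup>\<dagger> ** u = unit_cmat"
      using u(1) by (auto simp: unitary_group_def)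
    have scal: "scalar_matrices \<subseteq> D u"
      using A1 star_algebraD(5)[OF conjA[OF u(1)] unit_conj[OF u(1)]]
      by (auto simp: scalar_matrices_eq D_def star_algebraD)
    show ?thesis
    proof (cases "D u \<subseteq> scalar_matrices")
      case True
      then have "u \<in> Delta B1 B2"
        using scal u(1) by (auto simp: Delta_def D_def conj_def)
      then show ?thesis
        using u(2) by blast
    next
      case False
      then obtain X where "X \<in> D u" "X \<notin> scalar_matrices"
        by blast
      moreover have "unit_cmat \<in> D u"
        using A1 unit_conj[OF u(1)] by (simp add: D_def)
      ultimately obtain p where p: "projection p" "p \<in> D u" "p \<noteq> 0" "p \<noteq> unit_cmat"
        using star_algebra_scalar_or_projection[OF DA[OF u(1)]] by blast
      have pB: "p \<in> B1" "p \<in> conj u"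
        using p(2) by (auto simp: D_def)
      have comm: "\<exists>a\<in>B1. \<exists>c\<in>conj u. p ** q - q ** p = a + c" if q: "projection q" for q
      proof -
        define t where "t n = inverse (real (Suc n))" for n
        define w where "w n = unit_cmat + cmat_scale (cis (t n) - 1) q" for n
        have t0: "t \<longlonglongrightarrow> 0"
          unfolding t_def[abs_def] by (rule LIMSEQ_inverse_real_of_nat)
        have wU: "w n \<in> unitary_group" for n
          unfolding w_def by (intro unitary_add_projection q) simp
        have wuU: "w n ** u \<in> unitary_group" for n
          by (intro unitary_mult wU u)
        have "(\<lambda>n. cis (t n)) \<longlonglongrightarrow> cis 0"
          unfolding cis_conv_exp by (intro tendsto_intros t0)
        then have "w \<longlonglongrightarrow> unit_cmat + cmat_scale (cis 0 - 1) q"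
          unfolding w_def[abs_def] by (intro tendsto_add tendsto_const tendsto_cmat_scale tendsto_diff)
        then have w1: "w \<longlonglongrightarrow> unit_cmat"
          by simp
        have wu: "(\<lambda>n. w n ** u) \<longlonglongrightarrow> u"
          using tendsto_cmat_mult[OF w1 tendsto_const[of u]] by simp
        then have "\<forall>\<^sub>F n in sequentially. dist u0 (w n ** u) < \<epsilon>"
          using u(2) by (intro order_tendstoD(2)[OF tendsto_dist[OF tendsto_const]])
        \<comment> \<open>Minimality holds only inside the ball, so the sequence is shifted by
          \<open>N\<close> to keep every term there.\<close>
        then obtain N where N: "\<And>n. n \<ge> N \<Longrightarrow> dist u0 (w n ** u) < \<epsilon>"
          by (auto simp: eventually_sequentially)
        define S where "S n = D (w (n + N) ** u)" for n
        obtain r x where r: "strict_mono r" "\<And>n. x n \<in> S (r n)" "x \<longlonglongrightarrow> p"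
        proof (rule subspace_limit[of S "D u" p])
          show "Real_Vector_Spaces.subspace (S n)" for n
            unfolding S_def by (intro cmat_subspace_imp_subspace star_algebraD DA wuU)
          show "dim (D u) \<le> dim (S n)" for n
            unfolding S_def using N wuU by (intro min) (simp add: K_def)
          \<comment> \<open>Membership in the intersection amounts to two closed conditions, one in
            \<open>B1\<close> and one in \<open>B2\<close> after pulling back, and both survive the
            limit \<open>w\<close> \<longlonglongrightarrow> 1.\<close>
          show "l \<in> D u" if "strict_mono r" "\<forall>n. x n \<in> S (r n)" "x \<longlonglongrightarrow> l" for r x l
          proof -
            have mem: "x n \<in> B1" "(w (r n + N) ** u)\<^sup>\<dagger> ** x n ** (w (r n + N) ** u) \<in> B2" for n
              using that(2) mem_unitary_conjugate_iff[OF wuU] by (auto simp: S_def D_def conj_def)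
            have "filterlim (\<lambda>n. r n + N) sequentially sequentially"
              using that(1) by (intro filterlim_subseq) (simp add: strict_mono_def)
            then have "(\<lambda>n. w (r n + N) ** u) \<longlonglongrightarrow> u"
              by (rule filterlim_compose[OF wu])
            then have "(\<lambda>n. (w (r n + N) ** u)\<^sup>\<dagger> ** x n ** (w (r n + N) ** u)) \<longlonglongrightarrow> u\<^sup>\<dagger> ** l ** u"
              by (intro tendsto_cmat_mult tendsto_adjoint that(3))
            then have "u\<^sup>\<dagger> ** l ** u \<in> B2"
              by (rule closed_sequentially[OF closed_cmat_subspace[OF star_algebraD(1)[OF A2(1)]] mem(2)])
            moreover have "l \<in> B1"
              using that(3)
              by (rule closed_sequentially[OF closed_cmat_subspace[OF star_algebraD(1)[OF A1(1)]] mem(1)])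
            ultimately show ?thesis
              by (simp add: D_def conj_def mem_unitary_conjugate_iff[OF u(1)])
          qed
        qed (use p in auto)
        define s where "s n = r n + N" for n
        have s: "filterlim s sequentially sequentially"
          unfolding s_def[abs_def] using r(1) by (intro filterlim_subseq) (simp add: strict_mono_def)
        have xmem: "x n \<in> B1" "(w (s n))\<^sup>\<dagger> ** x n ** w (s n) \<in> conj u" for n
        proof -
          have "x n \<in> B1" "(w (s n) ** u)\<^sup>\<dagger> ** x n ** (w (s n) ** u) \<in> B2"
            using r(2)[of n] mem_unitary_conjugate_iff[OF wuU] by (auto simp: S_def D_def conj_def s_def)
          then show "x n \<in> B1" "(w (s n))\<^sup>\<dagger> ** x n ** w (s n) \<in> conj u"
            by (simp_all add: conj_def mem_unitary_conjugate_iff[OF u(1)] matrix_mul_assoc)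
        qed
        have "(\<lambda>n. t (s n)) \<longlonglongrightarrow> 0" "(\<lambda>n. (cis (t (s n)) - 1) / complex_of_real (t (s n))) \<longlonglongrightarrow> \<i>"
          using filterlim_compose[OF t0 s] filterlim_compose[OF cis_difference_quotient s]
          by (simp_all add: t_def)
        then show ?thesis
          by (rule commutator_in_sum[OF star_algebraD(1)[OF A1(1)] star_algebraD(1)[OF conjA[OF u(1)]] q])
            (use xmem r(3) in \<open>auto simp: w_def\<close>)
      qed
      \<comment> \<open>The estimate is to be made in \<open>B2\<close> itself, so the corner of the
        conjugate algebra is carried back by \<open>u\<close>.\<close>
      define p' where "p' = u\<^sup>\<dagger> ** p ** u"
      have p'B: "p' \<in> B2"
        using pB(2) by (simp add: p'_def conj_def mem_unitary_conjugate_iff[OF u(1)])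
      have p_eq: "p = u ** p' ** u\<^sup>\<dagger>"
        by (simp add: unitary_conjugate_eq_iff[OF u(1)] p'_def)
      have p'p': "p' ** p' = u\<^sup>\<dagger> ** (p ** (u ** u\<^sup>\<dagger>) ** p) ** u"
        by (simp only: p'_def matrix_mul_assoc)
      have pp': "projection p'"
        unfolding projection_def
        by (simp add: p'p' uu projectionD[OF p(1)]) (simp add: p'_def projectionD[OF p(1)] matrix_mul_assoc)
      have "rtrace p' = rtrace (u ** (u\<^sup>\<dagger> ** p))"
        unfolding p'_def by (rule rtrace_commute)
      then have tr: "rtrace p' = rtrace p"
        by (simp add: matrix_mul_assoc uu)
      have p'0: "p' \<noteq> 0" "p' \<noteq> unit_cmat"
        using p(3,4) p_eq uu by auto
      have "(\<lambda>X. p ** X ** (unit_cmat - p)) ` conj u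
          = (\<lambda>X. u ** X ** u\<^sup>\<dagger>) ` ((\<lambda>X. p' ** X ** (unit_cmat - p')) ` B2)"
      proof -
        have "p ** (u ** X ** u\<^sup>\<dagger>) ** (unit_cmat - p) = u ** (p' ** X ** (unit_cmat - p')) ** u\<^sup>\<dagger>" for X
        proof -
          have "p ** (u ** X ** u\<^sup>\<dagger>) ** (unit_cmat - p)
              = u ** (p' ** (u\<^sup>\<dagger> ** u) ** X ** ((u\<^sup>\<dagger> ** u) ** (unit_cmat - p') )) ** u\<^sup>\<dagger>"
            using uu by (simp add: p_eq cmat_distribs matrix_mul_assoc)
              (simp flip: matrix_mul_assoc add: uu)
          then show ?thesis
            by (simp add: uu)
        qed
        then show ?thesis
          by (simp add: conj_def image_image)
      qed
      then have "dim ((\<lambda>X. p ** X ** (unit_cmat - p)) ` conj u) \<le> dim ((\<lambda>X. p' ** X ** (unit_cmat - p')) ` B2)"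
        using dim_image_le[OF linear_corner] by metis
      moreover have "2 * rtrace p * (real CARD('n) - rtrace p)
          \<le> real (dim ((\<lambda>X. p ** X ** (unit_cmat - p)) ` B1)) + real (dim ((\<lambda>X. p ** X ** (unit_cmat - p)) ` conj u))"
        using comm by (intro corner_dim_le star_algebraD A1 conjA u p)
      ultimately have False
        using bound[OF p(1) pB(1) pp' p'B tr p(3,4) p'0] by linarith
      then show ?thesis ..
    qed
  qed
  have "u \<in> (top_of_set unitary_group) closure_of (Delta B1 B2)" if u: "u \<in> unitary_group" for u
    unfolding in_closure_of
  proof (intro conjI allI impI)
    show "u \<in> topspace (top_of_set unitary_group)"
      using u by simp
    fix T assume T: "u \<in> T \<and> openin (top_of_set unitary_group) T"
    then obtain e where "e > 0" "ball u e \<inter> unitary_group \<subseteq> T"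
      by (auto simp: openin_contains_ball)
    moreover from this obtain v where "v \<in> Delta B1 B2" "dist u v < e"
      using near[OF u] by blast
    ultimately show "\<exists>y. y \<in> Delta B1 B2 \<and> y \<in> T"
      by (auto simp: Delta_def)
  qed
  moreover have "(top_of_set unitary_group) closure_of (Delta B1 B2) \<subseteq> unitary_group"
    using closure_of_subset_topspace[of "top_of_set (unitary_group :: (complex^'n^'n) set)"] by simp
  ultimately show ?thesis
    by blast
qed

section \<open>The bounds for the algebras of the theorem\<close>

lemma projection_rtrace_ge_1:
  assumes "projection p" "p \<noteq> 0"
  shows "1 \<le> rtrace p"
proof -
  obtain n :: nat where "rtrace p = real n"
    using projection_rtrace_nat[OF assms(1)] by blast
  then show ?thesis
    using projection_rtrace_pos[OF assms] by simp
qed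

text \<open>Each of the d blocks has trace k times a multiplicity of at least 1, while the total is
  N = d k. So all multiplicities are 1 and the blocks have equal trace N/d.\<close>

lemma homogeneous_corner_bound:
  fixes B :: "(complex^'n^'n) set"
  assumes B: "unital_cstar_subalgebra B" and hom: "homogeneous_over_center B" and d: "0 < center_dim B"
    and p: "projection p" "p \<in> B"
  shows "real (dim ((\<lambda>X. p ** X ** (unit_cmat - p)) ` B))
    \<le> 2 * rtrace p * (real CARD('n) - rtrace p) / real (center_dim B)"
proof -
  let ?d = "center_dim B"
  define k where "k = CARD('n) div ?d"
  have dk: "CARD('n) = ?d * k"
    using hom by (simp add: homogeneous_over_center_def k_def)
  then have k: "0 < k"
    by (metis zero_less_card_finite mult_0_right gr0I less_irrefl)
  define ks where "ks = replicate ?d k"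
  have iso: "star_isomorphic_direct_sum B ks"
    using hom by (simp add: homogeneous_over_center_def k_def ks_def)
  have pos: "0 < ks ! i" if "i < length ks" for i
    using that k by (simp add: ks_def)
  obtain z f :: "nat \<Rightarrow> complex^'n^'n" where
    zf: "\<forall>i<length ks. projection (z i) \<and> z i \<in> B \<and> z i \<in> commutant B"
      "\<forall>i<length ks. \<forall>j<length ks. i \<noteq> j \<longrightarrow> z i ** z j = 0"
      "(\<Sum>i<length ks. z i) = unit_cmat"
      "\<forall>i<length ks. projection (f i) \<and> f i \<in> B \<and> f i \<noteq> 0 \<and> z i ** f i = f i"
      "\<forall>i<length ks. \<forall>X\<in>B. \<exists>a. f i ** X ** f i = cmat_scale a (f i)"
      "\<forall>i<length ks. rtrace (z i) = real (ks ! i) * rtrace (f i)"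
    by (rule star_isomorphism_blocks[OF iso unital_cstar_subalgebraD[OF B] pos])
  have z: "\<And>i. i < ?d \<Longrightarrow> projection (z i)" "\<And>i. i < ?d \<Longrightarrow> z i \<in> commutant B"
      "\<And>i j. i < ?d \<Longrightarrow> j < ?d \<Longrightarrow> i \<noteq> j \<Longrightarrow> z i ** z j = 0" "(\<Sum>i<?d. z i) = unit_cmat"
    and f: "\<And>i. i < ?d \<Longrightarrow> projection (f i)" "\<And>i. i < ?d \<Longrightarrow> f i \<noteq> 0"
    and tr: "\<And>i. i < ?d \<Longrightarrow> rtrace (z i) = real k * rtrace (f i)"
    using zf by (simp_all add: ks_def)
  have ge: "real k \<le> rtrace (z i)" if "i < ?d" for i
    using projection_rtrace_ge_1[OF f[OF that]] k by (simp add: tr[OF that])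
  have "(\<Sum>i<?d. rtrace (z i)) = real ?d * real k"
    by (simp add: z(4) rtrace_unit dk flip: rtrace_sum)
  then have "(\<Sum>i<?d. rtrace (z i) - real k) = 0"
    by (simp add: sum_subtractf)
  then have eq: "rtrace (z i) = real k" if "i < ?d" for i
    using ge that by (subst (asm) sum_nonneg_eq_0_iff) auto
  show ?thesis
    using equal_blocks_corner_bound[of "{..<?d}" z B p] z eq dk d p by simp
qed

text \<open>With N = 2 k m the blocks have traces k m n0 and m n1 for multiplicities n0, n1 \<ge> 1
  and total 2 k m. Something must remain for the second block, so n0 = 1; hence both traces are N/2
  and n1 = k, which exceeds 1.\<close>

lemma half_block_corner_bound:
  fixes B :: "(complex^'n^'n) set"
  assumes B: "unital_cstar_subalgebra B" and k: "k \<ge> 2" "2 * k dvd CARD('n)"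
    and iso': "star_isomorphic_direct_sum B [CARD('n) div 2, CARD('n) div (2 * k)]"
    and p: "projection p" "p \<in> B" "p \<noteq> 0" "p \<noteq> unit_cmat"
  shows "real (dim ((\<lambda>X. p ** X ** (unit_cmat - p)) ` B)) < rtrace p * (real CARD('n) - rtrace p)"
proof -
  obtain m where m: "CARD('n) = 2 * k * m"
    using k(2) by blast
  then have m0: "0 < m"
    by (metis zero_less_card_finite mult_0_right gr0I less_irrefl)
  have ks: "CARD('n) div 2 = k * m" "CARD('n) div (2 * k) = m"
    using m k(1) by simp_all
  define ks where "ks = [k * m, m]"
  have iso: "star_isomorphic_direct_sum B ks"
    using iso' by (simp add: ks ks_def)
  have pos: "0 < ks ! i" if "i < length ks" for i
    using that m0 k(1) by (auto simp: ks_def less_Suc_eq)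
  obtain z f :: "nat \<Rightarrow> complex^'n^'n" where
    zf: "\<forall>i<length ks. projection (z i) \<and> z i \<in> B \<and> z i \<in> commutant B"
      "\<forall>i<length ks. \<forall>j<length ks. i \<noteq> j \<longrightarrow> z i ** z j = 0"
      "(\<Sum>i<length ks. z i) = unit_cmat"
      "\<forall>i<length ks. projection (f i) \<and> f i \<in> B \<and> f i \<noteq> 0 \<and> z i ** f i = f i"
      "\<forall>i<length ks. \<forall>X\<in>B. \<exists>a. f i ** X ** f i = cmat_scale a (f i)"
      "\<forall>i<length ks. rtrace (z i) = real (ks ! i) * rtrace (f i)"
    by (rule star_isomorphism_blocks[OF iso unital_cstar_subalgebraD[OF B] pos])
  have z: "projection (z 0)" "projection (z 1)" "z 0 \<in> commutant B" "z 1 \<in> commutant B" "z 1 \<in> B"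
      "z 0 ** z 1 = 0" "z 1 ** z 0 = 0"
    and f: "projection (f 0)" "projection (f 1)" "f 0 \<noteq> 0" "f 1 \<noteq> 0" "f 1 \<in> B" "z 1 ** f 1 = f 1"
      "\<And>X. X \<in> B \<Longrightarrow> \<exists>a. f 1 ** X ** f 1 = cmat_scale a (f 1)"
    and sum: "z 0 + z 1 = unit_cmat"
    using zf by (simp_all add: ks_def)
  have tr0: "rtrace (z 0) = real (k * m) * rtrace (f 0)" and tr1: "rtrace (z 1) = real m * rtrace (f 1)"
    using zf(6) by (simp_all add: ks_def)
  have total: "rtrace (z 0) + rtrace (z 1) = 2 * real (k * m)"
    using arg_cong[OF sum, of rtrace] by (simp add: rtrace_add rtrace_unit m)
  obtain n :: nat where n: "rtrace (f 0) = real n"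
    using projection_rtrace_nat[OF f(1)] by auto
  have km: "0 < k * m"
    using m0 k(1) by simp
  have f1: "1 \<le> rtrace (f 1)" and f0: "1 \<le> rtrace (f 0)"
    using projection_rtrace_ge_1 f by auto
  have "rtrace (z 1) > 0"
    using f1 m0 unfolding tr1 by simp
  then have "real (k * m) * real n < real (k * m) * 2"
    using total by (simp add: tr0 n)
  then have "n < 2"
    using km by (simp only: mult_less_cancel_left_pos of_nat_0_less_iff)
  then have n1: "rtrace (f 0) = 1"
    using f0 n by simp
  have half: "rtrace (z 0) = real CARD('n) / 2" "rtrace (z 1) = real CARD('n) / 2"
    using total by (simp_all add: tr0 n1 m)
  have "rtrace (f 1) = real k"
    using half(2) m0 unfolding tr1 m by simp
  then have "rtrace (f 1) > 1"
    using k(1) by simp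
  then show ?thesis
    using half z sum f p
    by (intro unequal_blocks_corner_bound[OF unital_cstar_subalgebraD[OF B], of "z 0" "z 1" "f 1"]) auto
qed

section \<open>Density\<close>

theorem theorem4p1:
  fixes B1 B2 :: "(complex^'n^'n) set"
  assumes "unital_cstar_subalgebra B1" and "B1 \<noteq> UNIV"
    and "unital_cstar_subalgebra B2" and "B2 \<noteq> UNIV"
    and "(center_dim B1 = 1 \<and> center_dim B2 = 1)
       \<or> (center_dim B1 \<ge> 2 \<and> center_dim B2 = 1 \<and> homogeneous_over_center B1)
       \<or> (center_dim B1 = 2 \<and> center_dim B2 = 2 \<and>
          2 dvd CARD('n) \<and>
          star_isomorphic_direct_sum B1 [CARD('n) div 2, CARD('n) div 2] \<and>
          (\<exists>k\<ge>2. 2 * k dvd CARD('n) \<and>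
             star_isomorphic_direct_sum B2 [CARD('n) div 2, CARD('n) div (2 * k)]))
       \<or> (center_dim B1 \<ge> 2 \<and> center_dim B2 \<ge> 3 \<and>
          homogeneous_over_center B1 \<and> homogeneous_over_center B2)"
  shows "(top_of_set unitary_group) closure_of (Delta B1 B2) = unitary_group"
proof (rule dense_Delta_criterion[OF assms(1,3)])
  fix p p'
  assume p: "projection p" "p \<in> B1" "p \<noteq> 0" "p \<noteq> unit_cmat"
    and p': "projection p'" "p' \<in> B2" "p' \<noteq> 0" "p' \<noteq> unit_cmat" and tr: "rtrace p' = rtrace p"
  define R where "R = rtrace p * (real CARD('n) - rtrace p)"
  define D1 D2 where "D1 = real (dim ((\<lambda>X. p ** X ** (unit_cmat - p)) ` B1))"
    and "D2 = real (dim ((\<lambda>X. p' ** X ** (unit_cmat - p')) ` B2))"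
  have R: "0 < R"
    using projection_rtrace_pos[OF p(1,3)] projection_rtrace_pos[OF projection_compl[OF p(1)]] p(4)
    by (simp add: R_def rtrace_compl)
  have factor1: "D1 \<le> R / 2" if "center_dim B1 = 1"
    using factor_corner_bound[OF unital_cstar_subalgebraD[OF assms(1)] assms(2)
        center_subset_scalar_matrices[OF unital_cstar_subalgebraD(2)[OF assms(1)] that] p(1,2)]
    by (simp add: D1_def R_def)
  have factor2: "D2 \<le> R / 2" if "center_dim B2 = 1"
    using factor_corner_bound[OF unital_cstar_subalgebraD[OF assms(3)] assms(4)
        center_subset_scalar_matrices[OF unital_cstar_subalgebraD(2)[OF assms(3)] that] p'(1,2)]
    by (simp add: D2_def R_def tr)
  have scale: "2 * R / real d \<le> 2 * R / real m" if "0 < m" "m \<le> d" for d m :: nat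
    using that R by (intro divide_left_mono) auto
  have hom1: "D1 \<le> R" if "center_dim B1 \<ge> 2" "homogeneous_over_center B1"
  proof -
    have "D1 \<le> 2 * R / real (center_dim B1)"
      using homogeneous_corner_bound[OF assms(1) that(2) _ p(1,2)] that(1)
      by (simp add: D1_def R_def mult.assoc)
    also have "\<dots> \<le> 2 * R / real 2"
      using that(1) by (intro scale) auto
    finally show ?thesis
      by simp
  qed
  have hom2: "D2 \<le> 2 * R / 3" if "center_dim B2 \<ge> 3" "homogeneous_over_center B2"
  proof -
    have "D2 \<le> 2 * R / real (center_dim B2)"
      using homogeneous_corner_bound[OF assms(3) that(2) _ p'(1,2)] that(1)
      by (simp add: D2_def R_def mult.assoc tr)
    also have "\<dots> \<le> 2 * R / real 3"
      using that(1) by (intro scale) auto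
    finally show ?thesis
      by simp
  qed
  \<comment> \<open>\<open>2 * R\<close> is the real dimension of the full corner, so the fractions
    1/4, 1/2 and 1/3 appear as \<open>R / 2\<close>, \<open>R\<close> and
    \<open>2 * R / 3\<close>.\<close>
  have "D1 + D2 < 2 * R"
    using assms(5)
  proof (elim disjE conjE exE)
    assume "center_dim B1 = 1" "center_dim B2 = 1"
    then show ?thesis
      using factor1 factor2 R by linarith
  next
    assume "center_dim B1 \<ge> 2" "center_dim B2 = 1" "homogeneous_over_center B1"
    then show ?thesis
      using hom1 factor2 R by linarith
  next
    fix k
    assume *: "center_dim B1 = 2" "2 dvd CARD('n)"
        "star_isomorphic_direct_sum B1 [CARD('n) div 2, CARD('n) div 2]"
      and k: "k \<ge> 2" "2 * k dvd CARD('n)"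
        "star_isomorphic_direct_sum B2 [CARD('n) div 2, CARD('n) div (2 * k)]"
    \<comment> \<open>With a center of dimension 2 the two equal summands are the homogeneous form,
      so the first algebra costs at most \<open>R\<close> and strictness has to come from the
      second.\<close>
    have "homogeneous_over_center B1"
      using * by (simp add: homogeneous_over_center_def numeral_2_eq_2)
    moreover have "D2 < R"
      using half_block_corner_bound[OF assms(3) k p'] by (simp add: D2_def R_def tr)
    ultimately show ?thesis
      using hom1 * by linarith
  next
    assume "center_dim B1 \<ge> 2" "center_dim B2 \<ge> 3"
      "homogeneous_over_center B1" "homogeneous_over_center B2"
    then show ?thesis
      using hom1 hom2 R by linarith
  qed
  then show "real (dim ((\<lambda>X. p ** X ** (unit_cmat - p)) ` B1)) + real (dim ((\<lambda>X. p' ** X ** (unit_cmat - p')) ` B2))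
      < 2 * rtrace p * (real CARD('n) - rtrace p)"
    by (simp add: D1_def D2_def R_def mult.assoc)
qed

end
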